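(* Let $G$ be a bipartite graph with bipartition $(X,Y)$ such that no vertex of $X$ is isolated, and let $k\ge 1$ be an integer. If $\tau_Y(G)\ge k$, $k|Y|$ is even, and $|Y|\ge k+1$, then $G$ has a $(2,k)$-factor.
   Context: All graphs are finite. For a bipartite graph $G$ with bipartition $(X,Y)$ and $S\subseteq Y$, the strong-deletion $G\ominus S$ is the graph $G-(S\cup N_G(S))$, where $N_G(S)$ is the set of vertices adjacent to some vertex of $S$. $S\subseteq Y$ is a $Y$-cutset if $c(G\ominus S)\ge 2$, where $c(\cdot)$ denotes the number of connected components. The $Y$-toughness $\tau_Y(G)$ is the maximum real $t$ such that $|S|\ge t\cdot c(G\ominus S)$ for every $Y$-cutset $S$, or $\infty$ if $G$ has no $Y$-cutset. A $(2,k)$-factor of $G$ is a subgraph $F\subseteq G$ such that $d_F(x)=2$ for every $x\in V(F)\cap X$ and $d_F(y)=k$ for every $y\in Y$. *)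

theory Defs
  imports "Graph_Theory.Digraph_Component" "HOL-Library.Extended_Real"
begin

text \<open>
  Finite simple undirected graphs are represented by the locale predicate \<open>graph\<close> of the
  entry Graph_Theory: finite, loop-free, symmetric digraphs without parallel arcs. An undirected
  edge \<open>uv\<close> is the pair of arcs from \<open>u\<close> to \<open>v\<close> and from \<open>v\<close> to \<open>u\<close>. Hence
  the degree of a vertex is its out-degree, and the connected components are the
  strongly connected components.
\<close>

definition bipartition :: "('a, 'b) pre_digraph \<Rightarrow> 'a set \<Rightarrow> 'a set \<Rightarrow> bool" where
  "bipartition G X Y \<longleftrightarrow> X \<union> Y = verts G \<and> X \<inter> Y = {} \<and>
     (\<forall>u v. u \<rightarrow>\<^bsub>G\<^esub> v \<longrightarrow> u \<in> X \<and> v \<in> Y \<or> u \<in> Y \<and> v \<in> X)"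

definition isolated_vertex :: "('a, 'b) pre_digraph \<Rightarrow> 'a \<Rightarrow> bool" where
  "isolated_vertex G v \<longleftrightarrow> v \<in> verts G \<and> (\<nexists>w. v \<rightarrow>\<^bsub>G\<^esub> w)"

definition neighbourhood :: "('a, 'b) pre_digraph \<Rightarrow> 'a set \<Rightarrow> 'a set" where
  "neighbourhood G S = {v. \<exists>u\<in>S. u \<rightarrow>\<^bsub>G\<^esub> v}"

definition strong_deletion :: "('a, 'b) pre_digraph \<Rightarrow> 'a set \<Rightarrow> ('a, 'b) pre_digraph" where
  "strong_deletion G S = G \<restriction> (verts G - (S \<union> neighbourhood G S))"

text \<open>The null graph has no component, as \<^const>\<open>strongly_connected\<close> requires a vertex.\<close>

definition num_components :: "('a, 'b) pre_digraph \<Rightarrow> nat" where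
  "num_components G = card (pre_digraph.sccs G)"

definition Y_cutset :: "('a, 'b) pre_digraph \<Rightarrow> 'a set \<Rightarrow> 'a set \<Rightarrow> bool" where
  "Y_cutset G Y S \<longleftrightarrow> S \<subseteq> Y \<and> 2 \<le> num_components (strong_deletion G S)"

text \<open>The maximum is attained for finite \<open>Y\<close>; see \<open>Y_toughness_ge_iff\<close> below.\<close>

definition Y_toughness :: "('a, 'b) pre_digraph \<Rightarrow> 'a set \<Rightarrow> ereal" where
  "Y_toughness G Y =
     (if \<exists>S. Y_cutset G Y S
      then ereal (GREATEST t. \<forall>S. Y_cutset G Y S \<longrightarrow>
             real (card S) \<ge> t * real (num_components (strong_deletion G S)))
      else \<infinity>)"

text \<open>A factor covers all of \<open>Y\<close>, but may omit vertices of \<open>X\<close>.\<close>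

definition two_k_factor ::
    "('a, 'b) pre_digraph \<Rightarrow> 'a set \<Rightarrow> 'a set \<Rightarrow> nat \<Rightarrow> ('a, 'b) pre_digraph \<Rightarrow> bool" where
  "two_k_factor G X Y k F \<longleftrightarrow> graph F \<and> subgraph F G \<and> Y \<subseteq> verts F \<and>
     (\<forall>x \<in> verts F \<inter> X. out_degree F x = 2) \<and>
     (\<forall>y \<in> Y. out_degree F y = k)"

lemma Y_toughness_ge_iff:
  assumes "finite Y"
  shows "ereal t \<le> Y_toughness G Y \<longleftrightarrow>
    (\<forall>S. Y_cutset G Y S \<longrightarrow> t * real (num_components (strong_deletion G S)) \<le> real (card S))"
proof (cases "\<exists>S. Y_cutset G Y S")
  case False
  then show ?thesis by (simp add: Y_toughness_def)
next
  case True
  define c where "c S = real (num_components (strong_deletion G S))" for S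
  define C where "C = {S. Y_cutset G Y S}"
  define m where "m = Min ((\<lambda>S. real (card S) / c S) ` C)"
  have "C \<subseteq> Pow Y" by (auto simp: C_def Y_cutset_def)
  then have fin: "finite C" using assms by (simp add: finite_subset)
  have ne: "C \<noteq> {}" using True by (simp add: C_def)
  have pos: "c S > 0" if "S \<in> C" for S
    using that by (auto simp: C_def c_def Y_cutset_def)
  have iff: "(\<forall>S. Y_cutset G Y S \<longrightarrow> u * c S \<le> real (card S)) \<longleftrightarrow> u \<le> m" for u
  proof -
    have "(\<forall>S. Y_cutset G Y S \<longrightarrow> u * c S \<le> real (card S))
        \<longleftrightarrow> (\<forall>S\<in>C. u \<le> real (card S) / c S)"
      using pos by (auto simp: C_def pos_le_divide_eq)
    also have "\<dots> \<longleftrightarrow> u \<le> m" unfolding m_def using fin ne by (subst Min_ge_iff) auto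
    finally show ?thesis .
  qed
  have "(GREATEST u. \<forall>S. Y_cutset G Y S \<longrightarrow> u * c S \<le> real (card S)) = m"
    unfolding iff by (rule Greatest_equality) auto
  then have "Y_toughness G Y = ereal m" using True by (simp add: Y_toughness_def c_def)
  then show ?thesis using iff[of t] by (simp add: c_def)
qed

end

theory Submission
  imports Defs
begin

text \<open>
  Read \<open>G\<close> as a hypergraph on \<open>Y\<close> with hyperedges \<open>N x\<close>. Splitting every \<open>y\<close> into its incidences, with
  \<open>deg y - k\<close> further vertices absorbing the unused ones, turns a \<open>(2,k)\<close>-factor into a perfect
  matching; if there is none, the Tutte--Berge formula yields disjoint \<open>S, T \<subseteq> Y\<close>, a set \<open>R\<close> of
  hyperedges and a labelling of \<open>Y - S - T\<close> with too many odd classes (a barrier). Take a barrier with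
  \<open>card T + card R\<close> minimal. Every hyperedge selects at most two of its vertices in \<open>T\<close>, so
  that the total excess over \<open>k\<close> of the selection degrees is minimal; minimality of the barrier bounds the
  excess by the number of odd classes. A greedy independent set \<open>I\<close> of low degree vertices of \<open>T\<close>
  then gives the cutset made of \<open>S\<close>, of \<open>T - I\<close>, and of one vertex from each remaining hyperedge that
  would join two components. It has fewer than \<open>k\<close> vertices per component, against toughness; the
  degenerate case of a single component is handled by the cutset \<open>S \<union> T\<close> (plus at most \<open>card R\<close>
  vertices), or by counting \<open>Y\<close>.
\<close>

text \<open>The obstacle is one of accounting. The missing \<open>k - 1\<close> comes from
  minimality: if there are such units at all, there are at least two more odd classes than units,
  and this bound is used \<open>k - 1\<close> times. Each vertex of \<open>I\<close> has a budget of
  \<open>k * k\<close>, which covers its share of the shortfall below \<open>k\<close>, its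
  discarded neighbours and its hyperedges into \<open>Y - S - T\<close>. The other loss is that
  deletions can wipe out whole classes, which then yield no component. Such a class either keeps one
  vertex, attached to a vertex of \<open>I\<close>, or the estimate for the deleted vertices has one
  to spare.\<close>

section \<open>The Tutte--Berge formula\<close>

text \<open>A matching is encoded as the involution exchanging the ends of its edges.\<close>

definition matching_on :: "'v set \<Rightarrow> ('v \<Rightarrow> 'v \<Rightarrow> bool) \<Rightarrow> ('v \<Rightarrow> 'v) \<Rightarrow> bool" where
  "matching_on V E f \<longleftrightarrow>
     (\<forall>v. f (f v) = v) \<and> (\<forall>v. v \<notin> V \<longrightarrow> f v = v) \<and> (\<forall>v. f v \<noteq> v \<longrightarrow> E v (f v))"

definition exposed :: "'v set \<Rightarrow> ('v \<Rightarrow> 'v) \<Rightarrow> 'v set" where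
  "exposed V f = {v \<in> V. f v = v}"

text \<open>Labels replace components: if \<open>lab\<close> is constant along edges, every odd
  class contains an odd component, so odd labels bound the odd components from below.\<close>

definition odd_labels :: "'v set \<Rightarrow> ('v \<Rightarrow> 'c) \<Rightarrow> 'c set" where
  "odd_labels A lab = {c. odd (card {v \<in> A. lab v = c})}"

lemma finite_odd_labels: "finite A \<Longrightarrow> finite (odd_labels A lab)"
proof -
  assume "finite A"
  have "c \<in> lab ` A" if "c \<in> odd_labels A lab" for c
  proof -
    have "{v \<in> A. lab v = c} \<noteq> {}" using that unfolding odd_labels_def by (metis (no_types, lifting) card.empty even_zero mem_Collect_eq)
    then show ?thesis by auto
  qed
  then show ?thesis using \<open>finite A\<close> by (meson finite_imageI finite_subset subsetI)
qed

lemma even_card_involution: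
  assumes "finite A" "\<And>v. v \<in> A \<Longrightarrow> f v \<in> A \<and> f v \<noteq> v \<and> f (f v) = v"
  shows "even (card A)"
  using assms
proof (induction A rule: finite_psubset_induct)
  case (psubset A)
  show ?case
  proof (cases "A = {}")
    case False
    then obtain v where v: "v \<in> A" by auto
    let ?B = "A - {v, f v}"
    have "even (card ?B)"
    proof (rule psubset.IH)
      show "?B \<subset> A" using v by auto
      show "f w \<in> ?B \<and> f w \<noteq> w \<and> f (f w) = w" if "w \<in> ?B" for w
        using psubset.prems[of w] psubset.prems[of v] v that by (metis DiffD1 DiffD2 DiffI insert_iff empty_iff)
    qed
    moreover have "card A = card ?B + 2"
    proof -
      have "card ?B = card A - card {v, f v}"
        using psubset.prems v by (intro card_Diff_subset) auto
      moreover have "card {v, f v} = 2" using psubset.prems[OF v] by auto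
      moreover have "card {v, f v} \<le> card A" using psubset v by (intro card_mono) auto
      ultimately show ?thesis by linarith
    qed
    ultimately show ?thesis by simp
  qed simp
qed

lemma matching_on_mono: "matching_on V E f \<Longrightarrow> V \<subseteq> V' \<Longrightarrow> matching_on V' E f"
  by (auto simp: matching_on_def)

lemma matching_on_id: "matching_on V E (\<lambda>v. v)"
  by (simp add: matching_on_def)

lemma matching_on_closed:
  assumes "matching_on V E f" "v \<in> V" shows "f v \<in> V"
  using assms by (metis matching_on_def)

lemma exposed_parity:
  assumes "finite V" "matching_on V E f"
  shows "even (card (exposed V f)) \<longleftrightarrow> even (card V)"
proof -
  have "even (card (V - exposed V f))"
  proof (rule even_card_involution[where f = f])
    fix v assume "v \<in> V - exposed V f"
    then show "f v \<in> V - exposed V f \<and> f v \<noteq> v \<and> f (f v) = v"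
      using matching_on_closed[OF assms(2), of v] assms(2) by (auto simp: exposed_def matching_on_def)
  qed (use assms in auto)
  moreover have "card V = card (V - exposed V f) + card (exposed V f)"
    using assms(1) by (metis (no_types, lifting) card_Diff_subset card_mono exposed_def finite_subset le_add_diff_inverse2 mem_Collect_eq subsetI)
  ultimately show ?thesis by simp
qed

lemma matching_on_insert:
  assumes "matching_on V E f" "x \<in> V" "y \<in> V" "x \<noteq> y" "E x y" "E y x" "f x = x" "f y = y"
  shows "matching_on V E (f(x := y, y := x))"
    and "exposed V (f(x := y, y := x)) = exposed V f - {x, y}"
proof -
  have [simp]: "f v = x \<longleftrightarrow> v = x" "f v = y \<longleftrightarrow> v = y" for v
    using assms by (metis matching_on_def)+
  show "matching_on V E (f(x := y, y := x))" using assms unfolding matching_on_def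
    by (auto)
  show "exposed V (f(x := y, y := x)) = exposed V f - {x, y}"
    using assms by (auto simp: exposed_def)
qed

lemma matching_on_delete:
  assumes "matching_on V E f"
  shows "matching_on V E (f(x := x, f x := f x))"
proof -
  have "f v = x \<longleftrightarrow> v = f x" "f v = f x \<longleftrightarrow> v = x" for v
    using assms by (metis matching_on_def)+
  then show ?thesis using assms by (auto simp: matching_on_def)
qed

definition max_matching :: "'v set \<Rightarrow> ('v \<Rightarrow> 'v \<Rightarrow> bool) \<Rightarrow> ('v \<Rightarrow> 'v) \<Rightarrow> bool" where
  "max_matching V E f \<longleftrightarrow> matching_on V E f \<and>
     (\<forall>g. matching_on V E g \<longrightarrow> card (exposed V f) \<le> card (exposed V g))"

lemma max_matching_exists: "\<exists>f. max_matching V E f"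
  unfolding max_matching_def
  using exists_least_iff[of "\<lambda>n. \<exists>f. matching_on V E f \<and> card (exposed V f) = n"] matching_on_id[of V E]
  by (metis not_le)

lemma max_matching_card_eq:
  "max_matching V E f \<Longrightarrow> max_matching V E g \<Longrightarrow> card (exposed V f) = card (exposed V g)"
  by (simp add: le_antisym max_matching_def)

lemma exposed_not_adjacent:
  assumes "finite V" "symp E" "max_matching V E f" "u \<in> exposed V f" "v \<in> exposed V f" "u \<noteq> v"
  shows "\<not> E u v"
proof
  assume "E u v"
  then have "E v u" using assms(2) by (metis sympD)
  let ?g = "f(u := v, v := u)"
  have "matching_on V E ?g" "exposed V ?g = exposed V f - {u, v}"
    using matching_on_insert[of V E f u v] assms \<open>E u v\<close> \<open>E v u\<close>
    by (auto simp: exposed_def max_matching_def)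
  moreover have "exposed V f - {u, v} \<subset> exposed V f" using assms by auto
  moreover have "finite (exposed V f)" using assms by (auto simp: exposed_def)
  ultimately show False using assms(3) unfolding max_matching_def
    by (metis psubset_card_mono not_le)
qed

text \<open>
  The proof of Gallai's lemma: a maximum matching \<open>g\<close> missing \<open>v\<close> that agrees with \<open>f\<close> as much as
  possible also misses some \<open>x \<noteq> v\<close> covered by \<open>f\<close>, and exchanging one edge at \<open>f x\<close>
  increases the agreement.
\<close>
lemma jointly_missed_trans:
  fixes V :: "'v set"
  assumes "finite V" "symp E" "max_matching V E f" "u \<in> exposed V f" "w \<in> exposed V f" "u \<noteq> w"
    and "max_matching V E g0" "v \<in> exposed V g0"
  shows "\<exists>h. max_matching V E h \<and> v \<in> exposed V h \<and> (u \<in> exposed V h \<or> w \<in> exposed V h)"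
proof (rule ccontr)
  assume neg: "\<not> ?thesis"
  define P where "P g \<longleftrightarrow> max_matching V E g \<and> v \<in> exposed V g" for g
  define ag where "ag g = card {a \<in> V. f a = g a}" for g :: "'v \<Rightarrow> 'v"
  have "P g0" using assms unfolding P_def by simp
  moreover have "\<forall>g. P g \<longrightarrow> ag g < Suc (card V)"
    unfolding less_Suc_eq_le ag_def using \<open>finite V\<close> by (auto intro: card_mono)
  ultimately obtain g where g: "P g" and gmax: "\<And>h. P h \<Longrightarrow> ag h \<le> ag g"
    using ex_has_greatest_nat[of P g0 ag "Suc (card V)"] by blast
  have gm: "max_matching V E g" "v \<in> exposed V g" using g P_def by auto
  have "u \<notin> exposed V g" "w \<notin> exposed V g" using neg gm by auto
  have fin: "finite (exposed V h)" for h :: "'v \<Rightarrow> 'v" using \<open>finite V\<close> by (simp add: exposed_def)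
  \<comment> \<open>Both matchings are maximum, so each misses equally many vertices that the other
    covers. On the side of \<open>f\<close> these include \<open>u\<close> and \<open>w\<close>,
    which leaves room for some \<open>x\<close> other than \<open>v\<close>.\<close>
  have "card (exposed V f - exposed V g) = card (exposed V g - exposed V f)"
    using max_matching_card_eq[OF assms(3) gm(1)] fin[of f] fin[of g]
    by (metis (no_types, lifting) card_Diff_subset_Int Int_commute finite_Int)
  moreover have "card {u, w} \<le> card (exposed V f - exposed V g)"
    using assms \<open>u \<notin> exposed V g\<close> \<open>w \<notin> exposed V g\<close> fin by (intro card_mono) auto
  moreover have "card {u, w} = 2" using assms by simp
  ultimately have "card (exposed V g - exposed V f) > card {v}" by simp
  then have "\<not> exposed V g - exposed V f \<subseteq> {v}" by (metis card_mono finite.emptyI finite_insert not_le)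
  then obtain x where x: "x \<in> exposed V g" "x \<notin> exposed V f" "x \<noteq> v" by auto
  have fm: "matching_on V E f" and gm': "matching_on V E g" using assms gm by (auto simp: max_matching_def)
  define y where "y = f x"
  define z where "z = g y"
  have xV: "x \<in> V" and "g x = x" using x by (auto simp: exposed_def)
  have "y \<noteq> x" using x xV by (auto simp: exposed_def y_def)
  have yV: "y \<in> V" using matching_on_closed[OF fm xV] by (simp add: y_def)
  have fy: "f y = x" using fm by (auto simp: y_def matching_on_def)
  have "E x y" using fm \<open>y \<noteq> x\<close> by (auto simp: y_def matching_on_def)
  then have "E y x" using assms(2) by (metis sympD)
  have "z \<noteq> y"
    using exposed_not_adjacent[OF assms(1,2) gm(1), of x y] x(1) yV \<open>E x y\<close> \<open>y \<noteq> x\<close>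
    by (auto simp: z_def exposed_def)
  have gz: "g z = y" using gm' by (simp add: z_def matching_on_def)
  have zV: "z \<in> V" using matching_on_closed[OF gm' yV] by (simp add: z_def)
  have "z \<noteq> x" using gz \<open>g x = x\<close> \<open>y \<noteq> x\<close> by auto
  define h0 where "h0 = g(y := y, z := z)"
  have h0: "matching_on V E h0" using matching_on_delete[OF gm', of y] by (simp add: h0_def z_def)
  define h where "h = h0(x := y, y := x)"
  have h0x: "h0 x = x" "h0 y = y" using \<open>g x = x\<close> \<open>y \<noteq> x\<close> \<open>z \<noteq> x\<close> \<open>z \<noteq> y\<close> by (auto simp: h0_def)
  have h: "matching_on V E h" "exposed V h = exposed V h0 - {x, y}"
    using matching_on_insert[OF h0 xV yV] \<open>y \<noteq> x\<close> \<open>E x y\<close> \<open>E y x\<close> h0x by (auto simp: h_def)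
  have "exposed V h0 = insert y (insert z (exposed V g))"
    using yV zV by (auto simp: exposed_def h0_def)
  then have eh: "exposed V h = insert z (exposed V g - {x})"
    using h \<open>z \<noteq> x\<close> \<open>z \<noteq> y\<close> \<open>y \<noteq> x\<close> z_def unfolding exposed_def by auto
  have "card (exposed V h) \<le> Suc (card (exposed V g - {x}))"
    unfolding eh by (metis card_insert_le_m1 card_insert_if fin finite_Diff le_refl Suc_leD Suc_n_not_le_n nat_le_linear)
  also have "\<dots> = card (exposed V g)" using x fin by (metis card_Suc_Diff1)
  finally have "max_matching V E h" using h gm by (meson le_trans max_matching_def)
  moreover have "v \<in> exposed V h" using eh gm x by auto
  ultimately have "P h" by (simp add: P_def)
  have "{a \<in> V. f a = g a} \<subset> {a \<in> V. f a = h a}"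
  proof
    have "f z \<noteq> y"
    proof
      assume "f z = y"
      then have "z = x" using fm fy by (metis matching_on_def)
      with \<open>z \<noteq> x\<close> show False by simp
    qed
    show "{a \<in> V. f a = g a} \<subseteq> {a \<in> V. f a = h a}"
      using \<open>f z \<noteq> y\<close> gz by (auto simp: h_def h0_def y_def[symmetric] fy)
    have "x \<in> {a \<in> V. f a = h a}" "x \<notin> {a \<in> V. f a = g a}"
      using xV \<open>y \<noteq> x\<close> \<open>g x = x\<close> by (auto simp: h_def y_def)
    then show "{a \<in> V. f a = g a} \<noteq> {a \<in> V. f a = h a}" by blast
  qed
  then have "ag g < ag h" unfolding ag_def using \<open>finite V\<close> by (intro psubset_card_mono) auto
  then show False using gmax[OF \<open>P h\<close>] by simp
qed

text \<open>A vertex missed by no maximum matching is moved into \<open>U\<close> by induction. If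
  there is none, Gallai's lemma applies with \<open>U = {}\<close>; its equivalence classes serve as
  labels, which is why labels are sets of vertices.\<close>

theorem Tutte_Berge:
  fixes V :: "'v set"
  assumes "finite V" "symp E"
  shows "\<exists>f U (lab :: 'v \<Rightarrow> 'v set). matching_on V E f \<and> U \<subseteq> V \<and>
    (\<forall>v\<in>V - U. \<forall>w\<in>V - U. E v w \<longrightarrow> lab v = lab w) \<and>
    card (exposed V f) + card U \<le> card (odd_labels (V - U) lab)"
  using assms
proof (induction V rule: finite_psubset_induct)
  case (psubset V)
  obtain f where f: "max_matching V E f" using max_matching_exists by blast
  then have fm: "matching_on V E f" by (simp add: max_matching_def)
  show ?case
  proof (cases "\<exists>v\<in>V. \<forall>g. max_matching V E g \<longrightarrow> v \<notin> exposed V g")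
    case True
    then obtain v where v: "v \<in> V" "\<And>g. max_matching V E g \<Longrightarrow> v \<notin> exposed V g" by auto
    have "V - {v} \<subset> V" using v by auto
    from psubset.IH[OF this psubset.prems] obtain f' U and lab :: "'v \<Rightarrow> 'v set"
      where *: "matching_on (V - {v}) E f'" "U \<subseteq> V - {v}"
        "\<forall>a\<in>V - {v} - U. \<forall>b\<in>V - {v} - U. E a b \<longrightarrow> lab a = lab b"
        "card (exposed (V - {v}) f') + card U \<le> card (odd_labels (V - {v} - U) lab)" by blast
    have f'v: "f' v = v" using * by (simp add: matching_on_def)
    have f': "matching_on V E f'" using * matching_on_mono by blast
    have "exposed V f' = insert v (exposed (V - {v}) f')" using v f'v by (auto simp: exposed_def)
    then have c1: "card (exposed V f') = Suc (card (exposed (V - {v}) f'))"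
      using psubset.hyps by (simp add: exposed_def)
    have "\<not> max_matching V E f'" using v f'v by (auto simp: exposed_def)
    then have "card (exposed V f) < card (exposed V f')"
      using f f' by (metis (no_types, lifting) le_trans max_matching_def not_le)
    \<comment> \<open>By parity the strict inequality gains 2: one unit pays for \<open>v\<close>
      being exposed by \<open>f'\<close>, the other for \<open>v\<close> as a new element of
      \<open>U\<close>.\<close>
    moreover have "even (card (exposed V f)) \<longleftrightarrow> even (card (exposed V f'))"
      using exposed_parity[OF psubset.hyps fm] exposed_parity[OF psubset.hyps f'] by simp
    ultimately have "card (exposed V f) + 2 \<le> card (exposed V f')" by (metis Suc_leI add_2_eq_Suc' even_Suc le_neq_implies_less)
    moreover have "card (insert v U) = Suc (card U)"
      using *(2) psubset.hyps by (subst card_insert_disjoint) (auto intro: finite_subset)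
    moreover have "V - insert v U = V - {v} - U" by auto
    ultimately show ?thesis using fm * v c1
      by (intro exI[of _ f] exI[of _ "insert v U"] exI[of _ lab]) auto
  next
    case False
    \<comment> \<open>\<open>rel\<close> says that no maximum matching misses both vertices. Its
      transitivity is \<open>jointly_missed_trans\<close>, which requires the middle vertex to be
      missed by some maximum matching.\<close>
    define rel where "rel u w \<longleftrightarrow> u = w \<or> (\<forall>g. max_matching V E g \<longrightarrow> \<not> (u \<in> exposed V g \<and> w \<in> exposed V g))" for u w
    have sym: "rel u w \<Longrightarrow> rel w u" for u w by (auto simp: rel_def)
    have tr: "rel u w" if "rel u v" "rel v w" "v \<in> V" for u v w
    proof (rule ccontr)
      assume "\<not> rel u w"
      then obtain h where h: "u \<noteq> w" "max_matching V E h" "u \<in> exposed V h" "w \<in> exposed V h"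
        by (auto simp: rel_def)
      obtain g where g: "max_matching V E g" "v \<in> exposed V g" using False \<open>v \<in> V\<close> by auto
      have "u \<noteq> v" "v \<noteq> w" using \<open>\<not> rel u w\<close> that by auto
      with jointly_missed_trans[OF psubset.hyps psubset.prems h(2,3,4,1) g] that
      show False by (auto simp: rel_def)
    qed
    define lab where "lab u = {w \<in> V. rel u w}" for u
    have lab_eq: "lab u = lab w \<longleftrightarrow> rel u w" if "u \<in> V" "w \<in> V" for u w
    proof
      assume "lab u = lab w"
      moreover have "w \<in> lab w" using that by (simp add: lab_def rel_def)
      ultimately show "rel u w" by (auto simp: lab_def)
    next
      assume "rel u w"
      then show "lab u = lab w" using that tr sym unfolding lab_def by blast
    qed
    have edge: "rel u w" if "E u w" for u w
      unfolding rel_def using exposed_not_adjacent[OF psubset.hyps psubset.prems] that by blast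
    have inj: "inj_on lab (exposed V f)"
      using f by (intro inj_onI) (auto simp: exposed_def lab_eq rel_def)
    \<comment> \<open>A class contains at most one exposed vertex, and the edges of \<open>f\<close>
      stay within classes; so \<open>f\<close> pairs up the rest of the class of an exposed
      vertex.\<close>
    have "lab ` exposed V f \<subseteq> odd_labels V lab"
    proof
      fix c assume "c \<in> lab ` exposed V f"
      then obtain v where v: "v \<in> exposed V f" "c = lab v" by auto
      then have vV: "v \<in> V" "f v = v" by (auto simp: exposed_def)
      let ?C = "{w \<in> V. lab w = lab v}"
      have "even (card (?C - {v}))"
      proof (rule even_card_involution[where f = f])
        fix w assume w: "w \<in> ?C - {v}"
        have "f w \<noteq> w" using inj w v by (auto simp: inj_on_def exposed_def)
        moreover have fw: "f w \<in> V" using matching_on_closed[OF fm] w by auto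
        moreover have "f (f w) = w" using fm by (simp add: matching_on_def)
        moreover have "E w (f w)" using fm \<open>f w \<noteq> w\<close> by (simp add: matching_on_def)
        then have "lab w = lab (f w)" using lab_eq[of w "f w"] edge w fw by auto
        ultimately show "f w \<in> ?C - {v} \<and> f w \<noteq> w \<and> f (f w) = w" using w vV by auto
      qed (use psubset.hyps in auto)
      moreover have "card ?C = Suc (card (?C - {v}))"
        using vV psubset.hyps by (intro card.remove) auto
      ultimately show "c \<in> odd_labels V lab" using v by (simp add: odd_labels_def)
    qed
    then have "card (exposed V f) \<le> card (odd_labels V lab)"
      using inj psubset.hyps by (metis card_image card_mono finite_odd_labels)
    then show ?thesis using fm lab_eq edge
      by (intro exI[of _ f] exI[of _ "{}"] exI[of _ lab]) auto
  qed
qed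

section \<open>Tutte sets of minimal size\<close>

lemma card_odd_labels_merge:
  fixes V :: "'v set" and lab :: "'v \<Rightarrow> 'c"
  assumes "finite V" "U \<subseteq> V" "u \<in> U" and lab': "lab' = (\<lambda>w. if w = u \<or> lab w = b then a else lab w)"
  shows "card (odd_labels (V - U) lab) \<le> Suc (card (odd_labels (V - (U - {u})) lab'))"
proof -
  let ?O = "odd_labels (V - U) lab" and ?O' = "odd_labels (V - (U - {u})) lab'"
  let ?n = "\<lambda>c. card {v \<in> V - U. lab v = c}"
  have fin: "finite ?O" "finite ?O'" using assms by (auto intro: finite_odd_labels)
  have sub: "?O - {a, b} \<subseteq> ?O'"
  proof
    fix c assume c: "c \<in> ?O - {a, b}"
    then have "{v \<in> V - (U - {u}). lab' v = c} = {v \<in> V - U. lab v = c}"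
      using assms(3) by (auto simp: lab')
    then show "c \<in> ?O'" using c by (simp add: odd_labels_def)
  qed
  have "{v \<in> V - (U - {u}). lab' v = a} = insert u ({v \<in> V - U. lab v = a} \<union> {v \<in> V - U. lab v = b})"
    using assms by auto
  moreover have "card (insert u ({v \<in> V - U. lab v = a} \<union> {v \<in> V - U. lab v = b}))
      = Suc (card ({v \<in> V - U. lab v = a} \<union> {v \<in> V - U. lab v = b}))"
    using assms by (subst card_insert_disjoint) auto
  ultimately have ca: "card {v \<in> V - (U - {u}). lab' v = a} =
      Suc (card ({v \<in> V - U. lab v = a} \<union> {v \<in> V - U. lab v = b}))" by simp
  \<comment> \<open>Two odd classes together with \<open>u\<close> form an odd class again, so only
    one label is lost. In all other cases at most one of \<open>a\<close> and \<open>b\<close> was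
    an odd label.\<close>
  show ?thesis
  proof (cases "a \<noteq> b \<and> a \<in> ?O \<and> b \<in> ?O")
    case True
    then have "card ({v \<in> V - U. lab v = a} \<union> {v \<in> V - U. lab v = b}) = ?n a + ?n b"
      using assms by (subst card_Un_disjoint) auto
    then have "a \<in> ?O'" using ca True by (simp add: odd_labels_def)
    then have "?O - {b} \<subseteq> ?O'" using sub by blast
    then have "card (?O - {b}) \<le> card ?O'" using fin by (rule_tac card_mono) auto
    then show ?thesis using True fin by (metis Suc_le_mono card_Suc_Diff1)
  next
    case False
    then obtain d where "?O - {d} \<subseteq> ?O'" using sub by blast
    then have "card (?O - {d}) \<le> card ?O'" using fin by (rule_tac card_mono) auto
    moreover have "card ?O \<le> Suc (card (?O - {d}))" by (simp add: card_Diff_singleton_if, linarith)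
    ultimately show ?thesis by linarith
  qed
qed

text \<open>A sum of even numbers is even, so every odd class of the coarser labelling
  \<open>lab\<close> contains an odd class of \<open>lab'\<close>.\<close>

lemma odd_labels_refine:
  assumes "finite A" "\<And>v. v \<in> A \<Longrightarrow> lab v = g (lab' v)"
  shows "card (odd_labels A lab) \<le> card (odd_labels A lab')"
proof -
  have "odd_labels A lab \<subseteq> g ` odd_labels A lab'"
  proof
    fix c assume c: "c \<in> odd_labels A lab"
    show "c \<in> g ` odd_labels A lab'"
    proof (rule ccontr)
      assume "c \<notin> g ` odd_labels A lab'"
      then have ev: "even (card {v \<in> A. lab' v = d})" if "g d = c" for d
        using that by (auto simp: odd_labels_def)
      let ?D = "{d \<in> lab' ` A. g d = c}"
      have "{v \<in> A. lab v = c} = (\<Union>d\<in>?D. {v \<in> A. lab' v = d})" using assms(2) by auto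
      then have "card {v \<in> A. lab v = c} = (\<Sum>d\<in>?D. card {v \<in> A. lab' v = d})"
        using assms(1) by (simp only:) (subst card_UN_disjoint, auto)
      then have "even (card {v \<in> A. lab v = c})" using ev by (auto intro: dvd_sum)
      then show False using c by (simp add: odd_labels_def)
    qed
  qed
  then have "card (odd_labels A lab) \<le> card (g ` odd_labels A lab')"
    using assms(1) by (intro card_mono finite_imageI finite_odd_labels)
  also have "\<dots> \<le> card (odd_labels A lab')" using assms(1) by (intro card_image_le finite_odd_labels)
  finally show ?thesis .
qed

text \<open>If the neighbours of \<open>u\<close> outside \<open>U\<close> met only the classes
  \<open>a\<close> and \<open>b\<close>, then merging these with \<open>u\<close> would give a
  smaller set of the same kind. Two classes are excluded, since the tips seen by a slot fill one
  class and its cores must still meet two more.\<close>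

lemma minimal_Tutte_set:
  fixes V :: "'v set"
  assumes "finite V" "symp E" and noPM: "\<And>f. matching_on V E f \<Longrightarrow> exposed V f \<noteq> {}"
  obtains U and lab :: "'v \<Rightarrow> 'v set" where "U \<subseteq> V"
    "\<And>v w. v \<in> V - U \<Longrightarrow> w \<in> V - U \<Longrightarrow> E v w \<Longrightarrow> lab v = lab w"
    "card U < card (odd_labels (V - U) lab)"
    "\<And>u a b. u \<in> U \<Longrightarrow> \<exists>w\<in>V - U. E u w \<and> lab w \<noteq> a \<and> lab w \<noteq> b"
proof -
  define P where "P U \<longleftrightarrow> (\<exists>lab :: 'v \<Rightarrow> 'v set. U \<subseteq> V \<and>
    (\<forall>v\<in>V - U. \<forall>w\<in>V - U. E v w \<longrightarrow> lab v = lab w) \<and> card U < card (odd_labels (V - U) lab))" for U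
  obtain f U0 and lab0 :: "'v \<Rightarrow> 'v set" where f: "matching_on V E f" and 0: "U0 \<subseteq> V"
    "\<forall>v\<in>V - U0. \<forall>w\<in>V - U0. E v w \<longrightarrow> lab0 v = lab0 w"
    "card (exposed V f) + card U0 \<le> card (odd_labels (V - U0) lab0)"
    using Tutte_Berge[OF assms(1,2)] by blast
  have "card (exposed V f) > 0" using noPM[OF f] assms(1) by (simp add: exposed_def card_gt_0_iff)
  then have "P U0" using 0 unfolding P_def by (intro exI[of _ lab0]) auto
  then obtain U where U: "P U" and min: "\<And>U'. P U' \<Longrightarrow> card U \<le> card U'"
    using ex_has_least_nat[of P U0 card] by blast
  obtain lab :: "'v \<Rightarrow> 'v set" where lab: "U \<subseteq> V" "\<forall>v\<in>V - U. \<forall>w\<in>V - U. E v w \<longrightarrow> lab v = lab w"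
    "card U < card (odd_labels (V - U) lab)" using U unfolding P_def by blast
  show thesis
  proof (rule that[of U lab])
    fix u a b assume u: "u \<in> U"
    show "\<exists>w\<in>V - U. E u w \<and> lab w \<noteq> a \<and> lab w \<noteq> b"
    proof (rule ccontr)
      assume "\<not> ?thesis"
      then have nb: "lab w = a \<or> lab w = b" if "w \<in> V - U" "E u w" for w using that by blast
      define lab' where "lab' = (\<lambda>w. if w = u \<or> lab w = b then a else lab w)"
      have finU: "finite U" using lab(1) assms(1) finite_subset by blast
      have "card (odd_labels (V - U) lab) \<le> Suc (card (odd_labels (V - (U - {u})) lab'))"
        using card_odd_labels_merge[OF assms(1) lab(1) u lab'_def] .
      moreover have "card U = Suc (card (U - {u}))" using u finU by (metis card_Suc_Diff1)
      ultimately have "card (U - {u}) < card (odd_labels (V - (U - {u})) lab')" using lab(3) by linarith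
      moreover have "lab' v = lab' w" if "v \<in> V - (U - {u})" "w \<in> V - (U - {u})" "E v w" for v w
      proof -
        have "E w v" using that assms(2) by (metis sympD)
        then show ?thesis using that lab(2) nb[of v] nb[of w] unfolding lab'_def by auto
      qed
      ultimately have "P (U - {u})" unfolding P_def using lab(1) by (intro exI[of _ lab']) auto
      from min[OF this] \<open>card U = Suc (card (U - {u}))\<close> show False by simp
    qed
  qed (use lab in blast)+
qed

section \<open>Factors as perfect matchings\<close>

text \<open>
  \<open>Slot x y\<close> is the incidence of \<open>y\<close> with the hyperedge \<open>x\<close>. The vertices \<open>Core y i\<close> absorb the
  slots of \<open>y\<close> outside the factor, and the two adjacent vertices \<open>Tip x b\<close> are matched with each other
  or with the two slots of \<open>x\<close> in the factor.
\<close>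
datatype ('x, 'y) gadget = Slot 'x 'y | Core 'y nat | Tip 'x bool

fun gadget_edge :: "('x, 'y) gadget \<Rightarrow> ('x, 'y) gadget \<Rightarrow> bool" where
  "gadget_edge (Slot x y) (Core y' i) \<longleftrightarrow> y = y'"
| "gadget_edge (Core y' i) (Slot x y) \<longleftrightarrow> y = y'"
| "gadget_edge (Slot x y) (Tip x' b) \<longleftrightarrow> x = x'"
| "gadget_edge (Tip x' b) (Slot x y) \<longleftrightarrow> x = x'"
| "gadget_edge (Tip x b) (Tip x' b') \<longleftrightarrow> x = x' \<and> b \<noteq> b'"
| "gadget_edge _ _ \<longleftrightarrow> False"

lemma symp_gadget_edge: "symp gadget_edge"
proof (rule sympI)
  fix v w :: "('x, 'y) gadget" assume "gadget_edge v w" then show "gadget_edge w v"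
    by (cases v; cases w) auto
qed

locale hypergraph =
  fixes X :: "'x set" and Y :: "'y set" and N :: "'x \<Rightarrow> 'y set" and k :: nat
  assumes finite_X: "finite X" and finite_Y: "finite Y" and N_subset: "x \<in> X \<Longrightarrow> N x \<subseteq> Y"
begin

definition deg :: "'y \<Rightarrow> nat" where
  "deg y = card {x \<in> X. y \<in> N x}"

definition factor :: "('x \<Rightarrow> 'y set) \<Rightarrow> bool" where
  "factor p \<longleftrightarrow> (\<forall>x\<in>X. p x \<subseteq> N x \<and> (p x = {} \<or> card (p x) = 2)) \<and>
     (\<forall>y\<in>Y. card {x \<in> X. y \<in> p x} = k)"

text \<open>
  \<open>cost S T x\<close> is \<open>card (N x \<inter> T)\<close>, minus one if the two tips of \<open>x\<close> and its slots in \<open>T\<close> form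
  an odd component of the gadget graph on their own.
\<close>
definition cost :: "'y set \<Rightarrow> 'y set \<Rightarrow> 'x \<Rightarrow> nat" where
  "cost S T x = (if N x \<subseteq> S \<union> T then 2 * (card (N x \<inter> T) div 2) else card (N x \<inter> T))"

text \<open>Modulo 2 this is the size of a class in the gadget graph outside the Tutte set. A vertex
  \<open>y\<close> contributes \<open>deg y\<close> slots and \<open>deg y - k\<close> cores, which
  is \<open>k\<close> modulo 2; the two tips of a hyperedge cancel and its slots in \<open>T\<close>
  remain.\<close>

definition class_weight :: "'y set \<Rightarrow> 'y set \<Rightarrow> 'x set \<Rightarrow> ('y \<Rightarrow> 'c) \<Rightarrow> 'c \<Rightarrow> nat" where
  "class_weight S T R l c = k * card {y \<in> Y - S - T. l y = c} +
     (\<Sum>x | x \<in> X - R \<and> (\<exists>y\<in>N x - S - T. l y = c). card (N x \<inter> T))"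

definition odd_classes :: "'y set \<Rightarrow> 'y set \<Rightarrow> 'x set \<Rightarrow> ('y \<Rightarrow> 'c) \<Rightarrow> 'c set" where
  "odd_classes S T R l = {c \<in> l ` (Y - S - T). odd (class_weight S T R l c)}"

text \<open>Tutte's condition read in the hypergraph: the Tutte set consists of the slots at
  \<open>S\<close>, the cores at \<open>T\<close> and the tips of \<open>R\<close>. Hyperedges in
  \<open>R\<close> have lost their tips and therefore impose no condition on labels.\<close>

definition barrier :: "'y set \<Rightarrow> 'y set \<Rightarrow> 'x set \<Rightarrow> ('y \<Rightarrow> 'c) \<Rightarrow> bool" where
  "barrier S T R l \<longleftrightarrow> S \<subseteq> Y \<and> T \<subseteq> Y \<and> S \<inter> T = {} \<and> R \<subseteq> X \<and>
     (\<forall>x\<in>X - R. \<forall>y\<in>N x - S - T. \<forall>z\<in>N x - S - T. l y = l z) \<and>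
     k * card S + 2 * card R + (\<Sum>x\<in>X - R. cost S T x) < k * card T + card (odd_classes S T R l)"

lemma finite_N: "x \<in> X \<Longrightarrow> finite (N x)"
  using N_subset finite_Y finite_subset by blast

lemma sum_card_incidences:
  assumes "T \<subseteq> Y" "A \<subseteq> X" "\<And>x. x \<in> A \<Longrightarrow> p x \<subseteq> N x"
  shows "(\<Sum>t\<in>T. card {x \<in> A. t \<in> p x}) = (\<Sum>x\<in>A. card (p x \<inter> T))"
proof -
  have fA: "finite A" and fT: "finite T" using assms finite_X finite_Y finite_subset by blast+
  have "(\<Sum>t\<in>T. card {x \<in> A. t \<in> p x}) = (\<Sum>t\<in>T. \<Sum>x\<in>A. if t \<in> p x then 1 else 0)"
    using fA by (simp add: sum.If_cases Int_def)
  also have "\<dots> = (\<Sum>x\<in>A. \<Sum>t\<in>T. if t \<in> p x then 1 else 0)" by (rule sum.swap)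
  also have "\<dots> = (\<Sum>x\<in>A. card (p x \<inter> T))"
    using fT by (simp add: sum.If_cases Int_def conj_commute)
  finally show ?thesis .
qed

text \<open>This case is separate because \<open>deg y - k\<close>, the number of cores, is
  truncated at 0 if \<open>deg y < k\<close>, and the gadget graph then no longer encodes the degree
  \<open>k\<close>.\<close>

lemma barrier_if_deg_small:
  assumes "y \<in> Y" "deg y < k"
  shows "\<exists>S T R l. barrier S T R l"
proof -
  have "cost {} {y} x \<le> (if y \<in> N x then 1 else 0)" for x
    by (auto simp: cost_def Int_insert_right)
  then have "(\<Sum>x\<in>X. cost {} {y} x) \<le> (\<Sum>x\<in>X. if y \<in> N x then 1 else 0)" by (rule sum_mono)
  also have "\<dots> = deg y" using finite_X by (simp add: deg_def sum.If_cases Int_def)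
  finally have "barrier {} {y} {} (\<lambda>_. undefined)" using assms by (auto simp: barrier_def)
  then show ?thesis by blast
qed

section \<open>The gadget graph and its Tutte sets\<close>

definition gadget_verts :: "('x, 'y) gadget set" where
  "gadget_verts = (\<lambda>(y, x). Slot x y) ` (SIGMA y:Y. {x \<in> X. y \<in> N x}) \<union>
     (\<lambda>(y, i). Core y i) ` (SIGMA y:Y. {..<deg y - k}) \<union> (\<lambda>(x, b). Tip x b) ` (X \<times> UNIV)"

lemma gadget_verts_iff [simp]:
  "Slot x y \<in> gadget_verts \<longleftrightarrow> x \<in> X \<and> y \<in> N x"
  "Core y i \<in> gadget_verts \<longleftrightarrow> y \<in> Y \<and> i < deg y - k"
  "Tip x b \<in> gadget_verts \<longleftrightarrow> x \<in> X"
proof -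
  show "Slot x y \<in> gadget_verts \<longleftrightarrow> x \<in> X \<and> y \<in> N x"
  proof
    assume "x \<in> X \<and> y \<in> N x"
    then have "(y, x) \<in> (SIGMA y:Y. {x \<in> X. y \<in> N x})" using N_subset by auto
    then show "Slot x y \<in> gadget_verts" unfolding gadget_verts_def by force
  qed (auto simp: gadget_verts_def)
qed (auto simp: gadget_verts_def)

lemma finite_gadget_verts: "finite gadget_verts"
  using finite_X finite_Y by (auto simp: gadget_verts_def)

lemma factor_of_perfect_matching:
  assumes m: "matching_on gadget_verts gadget_edge f" and e: "exposed gadget_verts f = {}"
    and d: "\<And>y. y \<in> Y \<Longrightarrow> k \<le> deg y"
  shows "\<exists>p. factor p"
proof -
  define p where "p x = {y \<in> N x. \<exists>b. f (Slot x y) = Tip x b}" for x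
  have inv: "f (f v) = v" for v using m by (simp add: matching_on_def)
  have edge: "gadget_edge v (f v)" if "v \<in> gadget_verts" for v
    using m e that by (auto simp: matching_on_def exposed_def)
  have closed: "f v \<in> gadget_verts" if "v \<in> gadget_verts" for v
    using matching_on_closed[OF m that] .
  have slot: "(\<exists>b. f (Slot x y) = Tip x b) \<or> (\<exists>i<deg y - k. f (Slot x y) = Core y i)"
    if "x \<in> X" "y \<in> N x" for x y
    using edge[of "Slot x y"] closed[of "Slot x y"] that by (cases "f (Slot x y)") auto
  have core: "\<exists>x\<in>X. y \<in> N x \<and> f (Core y i) = Slot x y" if "y \<in> Y" "i < deg y - k" for y i
    using edge[of "Core y i"] closed[of "Core y i"] that by (cases "f (Core y i)") auto
  have tip: "(\<exists>y\<in>N x. f (Tip x b) = Slot x y) \<or> f (Tip x b) = Tip x (\<not> b)" if "x \<in> X" for x b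
    using edge[of "Tip x b"] closed[of "Tip x b"] that by (cases "f (Tip x b)") auto
  have c2: "p x = {} \<or> card (p x) = 2" if x: "x \<in> X" for x
  proof (cases "f (Tip x True) = Tip x False")
    case True
    then have "f (Tip x False) = Tip x True" using inv by metis
    then have "f (Tip x b) \<noteq> Slot x y" for b y using True by (cases b) auto
    then have "f (Slot x y) \<noteq> Tip x b" for b y using inv[of "Slot x y"] by auto
    then have "p x = {}" by (simp add: p_def)
    then show ?thesis by simp
  next
    case False
    then have "f (Tip x False) \<noteq> Tip x True" using inv by metis
    then obtain y1 y2 where y: "y1 \<in> N x" "f (Tip x True) = Slot x y1" "y2 \<in> N x" "f (Tip x False) = Slot x y2"
      using tip[OF x, of True] tip[OF x, of False] False by auto
    have "y1 \<noteq> y2" using y inv[of "Tip x True"] inv[of "Tip x False"] by auto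
    moreover have "p x = {y1, y2}"
    proof
      show "p x \<subseteq> {y1, y2}"
      proof
        fix z assume "z \<in> p x"
        then obtain b where "f (Slot x z) = Tip x b" by (auto simp: p_def)
        then have "f (Tip x b) = Slot x z" using inv by metis
        then show "z \<in> {y1, y2}" using y by (cases b) auto
      qed
      show "{y1, y2} \<subseteq> p x" using y inv[of "Tip x True"] inv[of "Tip x False"] by (auto simp: p_def)
    qed
    ultimately show ?thesis by simp
  qed
  have dk: "card {x \<in> X. y \<in> p x} = k" if y: "y \<in> Y" for y
  proof -
    let ?C = "{x \<in> X. y \<in> N x \<and> (\<exists>i<deg y - k. f (Slot x y) = Core y i)}"
    have "{x \<in> X. y \<in> N x} = {x \<in> X. y \<in> p x} \<union> ?C" using slot by (auto simp: p_def)
    moreover have "{x \<in> X. y \<in> p x} \<inter> ?C = {}" by (auto simp: p_def)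
    ultimately have "card {x \<in> X. y \<in> N x} = card {x \<in> X. y \<in> p x} + card ?C"
      using finite_X card_Un_disjoint[of "{x \<in> X. y \<in> p x}" ?C] by simp
    then have "deg y = card {x \<in> X. y \<in> p x} + card ?C" by (simp only: deg_def)
    moreover have "card ?C = deg y - k"
    proof -
      define h where "h i = (case f (Core y i) of Slot x _ \<Rightarrow> x)" for i
      have h: "h i \<in> X" "y \<in> N (h i)" "f (Core y i) = Slot (h i) y" if "i < deg y - k" for i
        using core[OF y that] by (auto simp: h_def)
      have "bij_betw h {..<deg y - k} ?C"
      proof (rule bij_betwI')
        show "h i = h j \<longleftrightarrow> i = j" if "i \<in> {..<deg y - k}" "j \<in> {..<deg y - k}" for i j
        proof
          assume "h i = h j"
          then have "f (f (Core y i)) = f (f (Core y j))" using h(3) that by simp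
          then show "i = j" using inv by simp
        qed simp
        show "h i \<in> ?C" if "i \<in> {..<deg y - k}" for i
        proof -
          have "f (Slot (h i) y) = Core y i" using h(3)[of i] that inv by (metis lessThan_iff)
          then show ?thesis using h[of i] that by auto
        qed
        show "\<exists>i\<in>{..<deg y - k}. x = h i" if "x \<in> ?C" for x
        proof -
          obtain i where "i < deg y - k" "f (Slot x y) = Core y i" using \<open>x \<in> ?C\<close> by blast
          then have "f (Core y i) = Slot x y" using inv by metis
          then show ?thesis using \<open>i < deg y - k\<close> by (intro bexI[of _ i]) (simp_all add: h_def)
        qed
      qed
      then show ?thesis using bij_betw_same_card by fastforce
    qed
    ultimately show ?thesis using d[OF y] by linarith
  qed
  have "factor p" unfolding factor_def using c2 dk by (auto simp: p_def)
  then show ?thesis by blast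
qed

lemma cost_parity: "cost S T x + (if N x \<subseteq> S \<union> T \<and> odd (card (N x \<inter> T)) then 1 else 0) = card (N x \<inter> T)"
  by (auto simp: cost_def)

text \<open>By \<open>three\<close>, the set \<open>U\<close> contains all or none of the cores of a
  vertex, of its slots, and of the two tips of a hyperedge: a vertex left outside \<open>U\<close>
  would force its twin in \<open>U\<close> to see too few classes. What remains is to count both
  sides of \<open>cardU\<close>.\<close>

lemma barrier_of_Tutte_set:
  fixes U :: "('x, 'y) gadget set" and lab :: "('x, 'y) gadget \<Rightarrow> 'c"
  assumes dk: "\<And>y. y \<in> Y \<Longrightarrow> k \<le> deg y" and U: "U \<subseteq> gadget_verts"
    and labE: "\<And>v w. v \<in> gadget_verts - U \<Longrightarrow> w \<in> gadget_verts - U \<Longrightarrow> gadget_edge v w \<Longrightarrow> lab v = lab w"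
    and cardU: "card U < card (odd_labels (gadget_verts - U) lab)"
    and three: "\<And>u a b. u \<in> U \<Longrightarrow> \<exists>w\<in>gadget_verts - U. gadget_edge u w \<and> lab w \<noteq> a \<and> lab w \<noteq> b"
  shows "\<exists>S T R (l :: 'y \<Rightarrow> 'c). barrier S T R l"
proof -
  let ?V = "gadget_verts" and ?E = "gadget_edge"
  have in_V: "v \<in> U \<Longrightarrow> v \<in> ?V" for v using U by auto
  have coreU: "Core y j \<in> U" if c: "Core y i \<in> U" "j < deg y - k" for y i j
  proof (rule ccontr)
    assume "Core y j \<notin> U"
    moreover have "y \<in> Y" using in_V[OF c(1)] by simp
    moreover obtain w where w: "w \<in> ?V - U" "?E (Core y i) w" "lab w \<noteq> lab (Core y j)"
      using three[OF c(1), of "lab (Core y j)" "lab (Core y j)"] by blast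
    ultimately show False using labE[of "Core y j" w] c by (cases w) auto
  qed
  have tipU: "Tip x b' \<in> U" if c: "Tip x b \<in> U" for x b b'
  proof (rule ccontr)
    assume no: "Tip x b' \<notin> U"
    moreover have "x \<in> X" using in_V[OF c(1)] by simp
    moreover obtain w where w: "w \<in> ?V - U" "?E (Tip x b) w" "lab w \<noteq> lab (Tip x b')"
      using three[OF c(1), of "lab (Tip x b')" "lab (Tip x b')"] by blast
    moreover have "b \<noteq> b'" by (rule notI) (use c no in simp)
    ultimately show False using labE[of "Tip x b'" w] c by (cases w) auto
  qed
  \<comment> \<open>The tips seen by the slot share one label, so it must see two classes of cores.
    Hence no core of \<open>y\<close> is in \<open>U\<close>, and any other slot at \<open>y\<close>
    outside \<open>U\<close> would join those two classes.\<close>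
  have slotU: "Core y i \<notin> U \<and> Slot x' y \<in> U"
    if c: "Slot x y \<in> U" "x' \<in> X" "y \<in> N x'" for x x' y i
  proof -
    have xy: "x \<in> X" "y \<in> N x" using in_V[OF c(1)] by auto
    have tips: "lab (Tip x b) = lab (Tip x True)" if "Tip x b \<notin> U" for b
      using that xy labE[of "Tip x b" "Tip x True"] tipU[of x True b] by (cases b) auto
    have nbr: "\<exists>j. Core y j \<in> ?V - U \<and> lab (Core y j) \<noteq> a" for a
    proof -
      obtain w where "w \<in> ?V - U" "?E (Slot x y) w" "lab w \<noteq> lab (Tip x True)" "lab w \<noteq> a"
        using three[OF c(1), of "lab (Tip x True)" a] by blast
      then show ?thesis using tips by (cases w) auto
    qed
    then obtain j where j: "Core y j \<in> ?V - U" by blast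
    obtain j' where j': "Core y j' \<in> ?V - U" "lab (Core y j') \<noteq> lab (Core y j)" using nbr by blast
    have "Core y i \<notin> U" using coreU[of y i j] j by auto
    moreover have "Slot x' y \<in> U"
    proof (rule ccontr)
      assume "Slot x' y \<notin> U"
      then have "lab (Core y j) = lab (Slot x' y)" "lab (Core y j') = lab (Slot x' y)"
        using c j j' labE[of "Core y j" "Slot x' y"] labE[of "Core y j'" "Slot x' y"] by simp_all
      with j' show False by simp
    qed
    ultimately show ?thesis by simp
  qed
  define S where "S = {y \<in> Y. \<exists>x. Slot x y \<in> U}"
  \<comment> \<open>A vertex outside \<open>S\<close> with \<open>deg y = k\<close> has no core and
    falls into \<open>T\<close>; so every vertex outside \<open>S\<close> and \<open>T\<close> has a
    core from which it takes its label.\<close>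
  define T where "T = {y \<in> Y - S. \<forall>i<deg y - k. Core y i \<in> U}"
  define R where "R = {x \<in> X. Tip x True \<in> U}"
  define l where "l y = lab (Core y 0)" for y
  have [simp]: "Slot x y \<in> U \<longleftrightarrow> x \<in> X \<and> y \<in> N x \<and> y \<in> S" for x y
  proof
    assume U: "Slot x y \<in> U"
    then show "x \<in> X \<and> y \<in> N x \<and> y \<in> S" using in_V[OF U] N_subset by (auto simp: S_def)
  next
    assume "x \<in> X \<and> y \<in> N x \<and> y \<in> S"
    then show "Slot x y \<in> U" using slotU unfolding S_def by blast
  qed
  have [simp]: "Tip x b \<in> U \<longleftrightarrow> x \<in> R" for x b
    using in_V[of "Tip x b"] tipU[of x b True] tipU[of x True b] unfolding R_def by simp blast
  have coreS: "Core y i \<notin> U" if y: "y \<in> S" for y i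
  proof -
    obtain x where x: "Slot x y \<in> U" using y S_def by blast
    then have "x \<in> X" "y \<in> N x" using in_V by fastforce+
    then show ?thesis using slotU[OF x] by blast
  qed
  have [simp]: "Core y i \<in> U \<longleftrightarrow> y \<in> T \<and> i < deg y - k" for y i
  proof
    assume U: "Core y i \<in> U"
    then have "y \<in> Y" "i < deg y - k" using in_V[OF U] by simp_all
    moreover have "y \<notin> S" using coreS U by blast
    ultimately show "y \<in> T \<and> i < deg y - k" using coreU[OF U] by (simp add: T_def)
  qed (simp add: T_def)
  have ST: "S \<subseteq> Y" "T \<subseteq> Y" "S \<inter> T = {}" "R \<subseteq> X" unfolding S_def T_def R_def by blast+
  have fin: "finite S" "finite T" "finite R" using ST finite_X finite_Y finite_subset by blast+
  have core0: "0 < deg y - k" if "y \<in> Y - S - T" for y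
  proof -
    have "\<exists>i<deg y - k. Core y i \<notin> U" using that unfolding T_def by blast
    then show ?thesis by linarith
  qed
  have core_lab: "lab (Core y i) = l y" if c: "y \<in> Y - S - T" "i < deg y - k" for y i
  proof -
    have "card {x \<in> X. y \<in> N x} \<noteq> 0" using core0[OF c(1)] unfolding deg_def by linarith
    then have "{x \<in> X. y \<in> N x} \<noteq> {}" by (intro notI) simp
    then obtain x where "x \<in> X" "y \<in> N x" by blast
    then have "lab (Core y i) = lab (Slot x y)" "lab (Core y 0) = lab (Slot x y)"
      using c core0[OF c(1)] labE[of "Core y i" "Slot x y"] labE[of "Core y 0" "Slot x y"] by simp_all
    then show ?thesis by (simp add: l_def)
  qed
  have slot_lab: "lab (Slot x y) = l y" if "y \<in> N x" "y \<notin> S" "y \<notin> T" "x \<in> X" for x y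
  proof -
    have "y \<in> Y - S - T" using that N_subset by auto
    then show ?thesis using core0[of y] that labE[of "Slot x y" "Core y 0"] unfolding l_def by simp
  qed
  have slot_tip: "lab (Slot x y) = lab (Tip x True)" if "y \<in> N x" "y \<notin> S" "x \<in> X - R" for x y
    using that labE[of "Slot x y" "Tip x True"] by simp
  have tip_tip: "lab (Tip x b) = lab (Tip x True)" if "x \<in> X - R" for x b
    using that labE[of "Tip x b" "Tip x True"] by (cases b) auto
  define t :: "'x \<Rightarrow> ('x, 'y) gadget + 'c" where
    "t x = (if N x \<subseteq> S \<union> T then Inl (Tip x True) else Inr (lab (Tip x True)))" for x
  \<comment> \<open>\<open>lab2\<close> refines \<open>lab\<close>, so that no odd class is lost. It
    separates the isolated cores at \<open>S\<close>, the isolated slots of \<open>R\<close> at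
    \<open>T\<close>, and the hyperedges contained in \<open>S \<union> T\<close>; the labels
    \<open>Inr c\<close> are the classes of the barrier.\<close>
  define lab2 where "lab2 v = (case v of
      Core y i \<Rightarrow> if y \<in> S then Inl (Core y i) else Inr (l y)
    | Slot x y \<Rightarrow> if y \<notin> T then Inr (l y) else if x \<in> R then Inl (Slot x y) else t x
    | Tip x b \<Rightarrow> t x)" for v
  have [simp]: "lab2 (Core y i) = (if y \<in> S then Inl (Core y i) else Inr (l y))"
    "lab2 (Slot x y) = (if y \<notin> T then Inr (l y) else if x \<in> R then Inl (Slot x y) else t x)"
    "lab2 (Tip x b) = t x" for x y i b by (simp_all add: lab2_def)
  have "card (odd_labels (?V - U) lab) \<le> card (odd_labels (?V - U) lab2)"
  proof (rule odd_labels_refine)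
    show "lab v = (case lab2 v of Inl w \<Rightarrow> lab w | Inr c \<Rightarrow> c)" if v: "v \<in> ?V - U" for v
    proof (cases v)
      case (Core y i)
      then have "y \<in> Y" "y \<notin> T" "i < deg y - k" using v by auto
      then show ?thesis using core_lab[of y i] Core by simp
    next
      case (Slot x y)
      then have "x \<in> X" "y \<in> N x" "y \<notin> S" using v by auto
      then show ?thesis using Slot slot_lab[of y x] slot_tip[of y x] by (simp add: t_def)
    next
      case (Tip x b)
      then have "x \<in> X - R" using v by auto
      then show ?thesis using Tip tip_tip[of x b] by (simp add: t_def)
    qed
  qed (use finite_gadget_verts in auto)
  also have "odd_labels (?V - U) lab2 \<subseteq>
     (Inl \<circ> (\<lambda>(y, i). Core y i)) ` (SIGMA y:S. {..<deg y - k}) \<union>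
     (Inl \<circ> (\<lambda>(x, y). Slot x y)) ` (SIGMA x:R. N x \<inter> T) \<union>
     (\<lambda>x. Inl (Tip x True)) ` {x \<in> X - R. N x \<subseteq> S \<union> T \<and> odd (card (N x \<inter> T))} \<union>
     Inr ` odd_classes S T R l" (is "_ \<subseteq> ?O1 \<union> ?O2 \<union> ?O3 \<union> ?O4")
  proof
    fix d assume d: "d \<in> odd_labels (?V - U) lab2"
    let ?D = "{v \<in> ?V - U. lab2 v = d}"
    have odd: "odd (card ?D)" using d by (simp add: odd_labels_def)
    then have "?D \<noteq> {}" by (metis card.empty even_zero)
    then obtain v where v: "v \<in> ?V - U" "lab2 v = d" by blast
    show "d \<in> ?O1 \<union> ?O2 \<union> ?O3 \<union> ?O4"
    proof (cases d)
      case (Inl w)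
      have "d \<in> ?O1 \<union> ?O2 \<or> (\<exists>x\<in>X - R. N x \<subseteq> S \<union> T \<and> d = Inl (Tip x True))"
        using v Inl by (cases v) (auto simp: t_def image_iff split: if_splits)
      then show ?thesis
      proof
        assume "\<exists>x\<in>X - R. N x \<subseteq> S \<union> T \<and> d = Inl (Tip x True)"
        then obtain x where x: "x \<in> X - R" "N x \<subseteq> S \<union> T" "d = Inl (Tip x True)" by blast
        have D: "?D = {Tip x True, Tip x False} \<union> Slot x ` (N x \<inter> T)" (is "_ = ?D'")
        proof (rule set_eqI)
          fix w
          show "w \<in> ?D \<longleftrightarrow> w \<in> ?D'"
          proof (cases w)
            case (Tip x' b)
            then show ?thesis using x by (cases b) (auto simp: t_def)
          qed (use x ST in \<open>auto simp: t_def\<close>)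
        qed
        have "card ?D = 2 + card (N x \<inter> T)"
          unfolding D using x fin by (subst card_Un_disjoint) (auto simp: card_image inj_on_def)
        then have "odd (card (N x \<inter> T))" using odd by simp
        then show ?thesis using x by auto
      qed auto
    next
      case (Inr c)
      let ?C = "{y \<in> Y - S - T. l y = c}"
      let ?X = "{x \<in> X - R. \<exists>y\<in>N x - S - T. l y = c}"
      let ?A1 = "(\<lambda>(y, i). Core y i :: ('x, 'y) gadget) ` (SIGMA y:?C. {..<deg y - k})"
      let ?A2 = "(\<lambda>(y, x). Slot x y) ` (SIGMA y:?C. {x \<in> X. y \<in> N x})"
      let ?A3 = "(\<lambda>(x, b). Tip x b :: ('x, 'y) gadget) ` (?X \<times> UNIV)"
      let ?A4 = "(\<lambda>(x, y). Slot x y) ` (SIGMA x:?X. N x \<inter> T)"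
      have tX: "t x = Inr c \<longleftrightarrow> x \<in> ?X" if "x \<in> X - R" for x
      proof -
        have "lab (Tip x True) = l y" if "y \<in> N x - S - T" for y
          using slot_tip[of y x] slot_lab[of y x] that \<open>x \<in> X - R\<close> by auto
        then show ?thesis using that by (auto simp: t_def)
      qed
      have D: "?D = (?A1 \<union> ?A2) \<union> (?A3 \<union> ?A4)"
      proof (rule set_eqI)
        fix w
        show "w \<in> ?D \<longleftrightarrow> w \<in> (?A1 \<union> ?A2) \<union> (?A3 \<union> ?A4)"
        proof (cases w)
          case (Tip x b)
          then show ?thesis using Inr tX[of x] by auto
        next
          case (Core y i)
          then show ?thesis using Inr by auto
        next
          case (Slot x y)
          have "y \<in> N x \<Longrightarrow> x \<in> X \<Longrightarrow> y \<in> Y" using N_subset by auto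
          then show ?thesis using Slot Inr tX[of x] ST by auto
        qed
      qed
      have fC: "finite ?C" "finite ?X" using finite_X finite_Y by auto
      have fN: "finite (N x \<inter> T)" for x using fin by auto
      have c1: "card ?A1 = (\<Sum>y\<in>?C. deg y - k)"
        using fC by (subst card_image) (auto simp: inj_on_def)
      have c2: "card ?A2 = (\<Sum>y\<in>?C. deg y)"
        using fC finite_X by (subst card_image) (auto simp: inj_on_def deg_def)
      have c3: "card ?A3 = card ?X * 2"
        using fC by (subst card_image) (auto simp: inj_on_def card_cartesian_product card_UNIV_bool)
      have c4: "card ?A4 = (\<Sum>x\<in>?X. card (N x \<inter> T))"
        using fC fN by (subst card_image) (auto simp: inj_on_def)
      have f: "finite ?A1" "finite ?A2" "finite ?A3" "finite ?A4"
        using fC fN finite_X by (auto intro!: finite_imageI finite_SigmaI)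
      have "card ?D = (card ?A1 + card ?A2) + (card ?A3 + card ?A4)"
      proof -
        have d: "?A1 \<inter> ?A2 = {}" "?A3 \<inter> ?A4 = {}" "(?A1 \<union> ?A2) \<inter> (?A3 \<union> ?A4) = {}" by auto
        show ?thesis unfolding D card_Un_disjoint[OF finite_UnI[OF f(1,2)] finite_UnI[OF f(3,4)] d(3)]
            card_Un_disjoint[OF f(1,2) d(1)] card_Un_disjoint[OF f(3,4) d(2)] by (rule refl)
      qed
      also have "(card ?A1 + card ?A2) = (\<Sum>y\<in>?C. 2 * (deg y - k) + k)"
        unfolding c1 c2 sum.distrib[symmetric]
      proof (rule sum.cong)
        fix y assume "y \<in> ?C"
        then have "k \<le> deg y" using dk by auto
        then show "deg y - k + deg y = 2 * (deg y - k) + k" by simp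
      qed simp
      also have "\<dots> = 2 * (\<Sum>y\<in>?C. deg y - k) + k * card ?C"
        by (simp add: sum.distrib sum_distrib_left)
      finally have "odd (class_weight S T R l c)"
        using odd unfolding class_weight_def c3 c4 by simp
      moreover have "c \<in> l ` (Y - S - T)"
      proof -
        have "y \<in> N x \<Longrightarrow> x \<in> X \<Longrightarrow> y \<in> Y" for x y using N_subset by auto
        then show ?thesis using v Inr tX by (cases v) (auto split: if_splits)
      qed
      ultimately show ?thesis using Inr by (auto simp: odd_classes_def)
    qed
  qed
  then have "card (odd_labels (?V - U) lab2) \<le> card (?O1 \<union> ?O2 \<union> ?O3 \<union> ?O4)"
    using fin finite_X finite_Y by (intro card_mono) (auto simp: odd_classes_def)
  also have "\<dots> \<le> card ?O1 + card ?O2 + card ?O3 + card ?O4"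
    by (meson add_mono card_Un_le le_refl order_trans)
  finally have O: "card (odd_labels (?V - U) lab) \<le> card ?O1 + card ?O2 + card ?O3 + card ?O4" .
  let ?odd = "{x \<in> X - R. N x \<subseteq> S \<union> T \<and> odd (card (N x \<inter> T))}"
  have "card ?O1 = (\<Sum>y\<in>S. deg y - k)"
    using fin by (subst card_image) (auto simp: inj_on_def)
  moreover have "card ?O2 = (\<Sum>x\<in>R. card (N x \<inter> T))"
    using fin by (subst card_image) (auto simp: inj_on_def)
  moreover have "card ?O3 = card ?odd" by (subst card_image) (auto simp: inj_on_def)
  moreover have "card ?O4 = card (odd_classes S T R l)" by (subst card_image) (auto simp: inj_on_def)
  moreover have "card U = (\<Sum>y\<in>S. deg y) + (\<Sum>y\<in>T. deg y - k) + 2 * card R"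
  proof -
    let ?A1 = "(\<lambda>(y, x). Slot x y) ` (SIGMA y:S. {x \<in> X. y \<in> N x})"
    let ?A2 = "(\<lambda>(y, i). Core y i :: ('x, 'y) gadget) ` (SIGMA y:T. {..<deg y - k})"
    let ?A3 = "(\<lambda>(x, b). Tip x b :: ('x, 'y) gadget) ` (R \<times> UNIV)"
    have "U = ?A1 \<union> ?A2 \<union> ?A3"
    proof (rule set_eqI)
      show "w \<in> U \<longleftrightarrow> w \<in> ?A1 \<union> ?A2 \<union> ?A3" for w by (cases w) (auto simp: image_iff)
    qed
    moreover have "card (?A1 \<union> ?A2 \<union> ?A3) = card ?A1 + card ?A2 + card ?A3"
    proof -
      have f: "finite ?A1" "finite ?A2" "finite ?A3" using fin finite_X by auto
      have d: "?A1 \<inter> ?A2 = {}" "(?A1 \<union> ?A2) \<inter> ?A3 = {}" by auto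
      show ?thesis unfolding card_Un_disjoint[OF finite_UnI[OF f(1,2)] f(3) d(2)]
          card_Un_disjoint[OF f(1,2) d(1)] by (rule refl)
    qed
    moreover have "card ?A1 = (\<Sum>y\<in>S. deg y)"
      using fin finite_X by (subst card_image) (auto simp: inj_on_def deg_def)
    moreover have "card ?A2 = (\<Sum>y\<in>T. deg y - k)"
      using fin by (subst card_image) (auto simp: inj_on_def)
    moreover have "card ?A3 = card R * 2"
      using fin by (subst card_image) (auto simp: inj_on_def card_cartesian_product card_UNIV_bool)
    ultimately show ?thesis by simp
  qed
  moreover have "(\<Sum>y\<in>A. deg y) = (\<Sum>y\<in>A. deg y - k) + k * card A" if "A \<subseteq> Y" for A
  proof -
    have "(\<Sum>y\<in>A. deg y) = (\<Sum>y\<in>A. deg y - k + k)" using dk that by (intro sum.cong) auto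
    then show ?thesis by (simp add: sum.distrib)
  qed
  note this[OF ST(1)] this[OF ST(2)]
  \<comment> \<open>The slots at \<open>T\<close> split along \<open>R\<close>: those of
    \<open>R\<close> are the singletons in \<open>?O2\<close> and cancel, the others turn into the
    costs.\<close>
  moreover have "(\<Sum>y\<in>T. deg y) = (\<Sum>x\<in>R. card (N x \<inter> T)) + (\<Sum>x\<in>X - R. card (N x \<inter> T))"
    using sum_card_incidences[OF ST(2) order_refl, of N] sum.subset_diff[OF ST(4) finite_X]
    by (simp add: deg_def add.commute)
  moreover have "(\<Sum>x\<in>X - R. card (N x \<inter> T)) = (\<Sum>x\<in>X - R. cost S T x) + card ?odd"
  proof -
    have "(\<Sum>x\<in>X - R. card (N x \<inter> T)) =
        (\<Sum>x\<in>X - R. cost S T x + (if N x \<subseteq> S \<union> T \<and> odd (card (N x \<inter> T)) then 1 else 0))"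
      by (simp only: cost_parity)
    also have "\<dots> = (\<Sum>x\<in>X - R. cost S T x) + card ?odd"
      using finite_X by (simp add: sum.distrib sum.If_cases Int_def conj_commute)
    finally show ?thesis .
  qed
  ultimately have "k * card S + 2 * card R + (\<Sum>x\<in>X - R. cost S T x) < k * card T + card (odd_classes S T R l)"
    using cardU O by linarith
  moreover have "l y = l z" if "x \<in> X - R" "y \<in> N x - S - T" "z \<in> N x - S - T" for x y z
    using slot_tip[of y x] slot_tip[of z x] slot_lab[of y x] slot_lab[of z x] that by auto
  ultimately have "barrier S T R l" unfolding barrier_def using ST by blast
  then show ?thesis by blast
qed

lemma exists_barrier:
  assumes nf: "\<nexists>p. factor p"
  shows "\<exists>S T R (l :: 'y \<Rightarrow> ('x, 'y) gadget set). barrier S T R l"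
proof (cases "\<exists>y\<in>Y. deg y < k")
  case True
  then show ?thesis using barrier_if_deg_small by blast
next
  case False
  then have dk: "\<And>y. y \<in> Y \<Longrightarrow> k \<le> deg y" by (simp add: not_less)
  have no_pm: "exposed gadget_verts f \<noteq> {}" if "matching_on gadget_verts gadget_edge f" for f
    using factor_of_perfect_matching[OF that] dk nf by blast
  show ?thesis
    by (rule minimal_Tutte_set[OF finite_gadget_verts symp_gadget_edge no_pm])
      (assumption, rule barrier_of_Tutte_set[OF dk])
qed

end

section \<open>Minimal barriers\<close>

locale minimal_barrier = hypergraph X Y N k
  for X :: "'x set" and Y :: "'y set" and N k +
  fixes S T :: "'y set" and R :: "'x set" and l :: "'y \<Rightarrow> 'c"
  assumes barrier: "barrier S T R l"
    and minimal: "\<And>S' T' R' (l' :: 'y \<Rightarrow> 'c). barrier S' T' R' l' \<Longrightarrow> card T + card R \<le> card T' + card R'"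
    and even_kY: "even (k * card Y)"
begin

lemma ST: "S \<subseteq> Y" "T \<subseteq> Y" "S \<inter> T = {}" "R \<subseteq> X"
  and label_eq: "\<lbrakk>x \<in> X - R; y \<in> N x - S - T; z \<in> N x - S - T\<rbrakk> \<Longrightarrow> l y = l z"
  and barrier_less: "k * card S + 2 * card R + (\<Sum>x\<in>X - R. cost S T x) < k * card T + card (odd_classes S T R l)"
  using barrier unfolding barrier_def by blast+

lemma fin: "finite S" "finite T" "finite R"
  using ST finite_X finite_Y finite_subset by blast+

lemma cost_le: "cost S T' x \<le> card (N x \<inter> T')"
  by (simp add: cost_def)

text \<open>The critical hyperedge is contained in \<open>S \<union> T\<close> but not in
  \<open>S \<union> T1\<close>: its cost over \<open>T1\<close> is not rounded down. It has lost a
  vertex of \<open>T\<close>, which makes up for the rounding.\<close>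

lemma cost_mono:
  assumes "T1 \<subseteq> T" shows "cost S T1 x \<le> cost S T x"
proof -
  have fT: "finite (N x \<inter> T)" using fin by simp
  have le: "card (N x \<inter> T1) \<le> card (N x \<inter> T)" using assms fT by (intro card_mono) auto
  have "card (N x \<inter> T1) < card (N x \<inter> T)" if "N x \<subseteq> S \<union> T" "\<not> N x \<subseteq> S \<union> T1"
    using that assms fT by (intro psubset_card_mono) auto
  note lt = this
  show ?thesis
  proof (cases "N x \<subseteq> S \<union> T \<and> \<not> N x \<subseteq> S \<union> T1")
    case True
    then show ?thesis using lt unfolding cost_def by simp
  next
    case False
    then show ?thesis using le assms by (auto simp: cost_def div_le_mono)
  qed
qed

text \<open>Both sides of the barrier inequality have the same parity, so a strict inequality leaves
  a gap of 2. Summing the class weights gives the parity of the number of odd classes, hyperedges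
  inside \<open>S \<union> T\<close> have even cost, and the multiples of \<open>k\<close> add up to
  the even number \<open>k * card Y\<close>.\<close>

lemma barrier_slack:
  "k * card S + 2 * card R + (\<Sum>x\<in>X - R. cost S T x) + 2 \<le> k * card T + card (odd_classes S T R l)"
proof -
  let ?U = "Y - S - T"
  let ?A = "{x \<in> X - R. \<not> N x \<subseteq> S \<union> T}"
  let ?X = "\<lambda>c. {x \<in> X - R. \<exists>y\<in>N x - S - T. l y = c}"
  have fU: "finite ?U" using finite_Y by simp
  have eq: "?A = (\<Union>c\<in>l ` ?U. ?X c)" using N_subset by blast
  have "(\<Sum>x\<in>?A. card (N x \<inter> T)) = (\<Sum>c\<in>l ` ?U. \<Sum>x\<in>?X c. card (N x \<inter> T))"
    unfolding eq
  proof (rule sum.UNION_disjoint)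
    show "\<forall>i\<in>l ` ?U. \<forall>j\<in>l ` ?U. i \<noteq> j \<longrightarrow> ?X i \<inter> ?X j = {}" using label_eq by blast
  qed (use fU finite_X in auto)
  moreover have "card ?U = (\<Sum>c\<in>l ` ?U. card {y \<in> ?U. l y = c})"
    using sum.group[OF fU finite_imageI[OF fU] order_refl, where g = l and h = "\<lambda>_. 1::nat"] by simp
  ultimately have "(\<Sum>c\<in>l ` ?U. class_weight S T R l c) = k * card ?U + (\<Sum>x\<in>?A. card (N x \<inter> T))"
    by (simp add: class_weight_def sum.distrib sum_distrib_left)
  then have q: "even (card (odd_classes S T R l)) \<longleftrightarrow> even (k * card ?U + (\<Sum>x\<in>?A. card (N x \<inter> T)))"
    unfolding odd_classes_def using even_sum_iff[of "l ` ?U" "class_weight S T R l"] fU by simp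
  have "(\<Sum>x\<in>X - R. cost S T x) =
      (\<Sum>x\<in>?A. cost S T x) + (\<Sum>x\<in>X - R - ?A. cost S T x)"
    using finite_X by (intro sum.subset_diff[THEN trans, OF _ _ add.commute]) auto
  also have "(\<Sum>x\<in>?A. cost S T x) = (\<Sum>x\<in>?A. card (N x \<inter> T))"
    by (intro sum.cong) (auto simp: cost_def)
  finally have "even (\<Sum>x\<in>X - R. cost S T x) \<longleftrightarrow> even (\<Sum>x\<in>?A. card (N x \<inter> T))"
    by (simp, subst dvd_sum) (auto simp: cost_def)
  moreover have "card Y = card S + card T + card ?U"
  proof -
    have "card (Y - S) = card Y - card S" "card (Y - S - T) = card (Y - S) - card T"
      using ST fin by (intro card_Diff_subset, auto)+
    moreover have "card S \<le> card Y" "card T \<le> card (Y - S)"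
      using ST finite_Y by (intro card_mono, auto)+
    ultimately show ?thesis by linarith
  qed
  then have "even (k * card S + k * card T + k * card ?U)" using even_kY by (simp add: distrib_left)
  ultimately have "even (k * card S + 2 * card R + (\<Sum>x\<in>X - R. cost S T x)) \<longleftrightarrow>
      even (k * card T + card (odd_classes S T R l))" using q by auto
  moreover have "a + 2 \<le> b" if "even a \<longleftrightarrow> even b" "a < b" for a b :: nat
    using that by presburger
  ultimately show ?thesis using barrier_less by blast
qed

text \<open>A constant labelling meets the label condition for any choice of sets, so by minimality
  the barrier inequality fails for it, even with the odd classes discounted.\<close>

lemma smaller_not_barrier:
  assumes "T1 \<subseteq> T" "R1 \<subseteq> R" "T1 \<noteq> T \<or> R1 \<noteq> R"
  shows "k * card T1 \<le> k * card S + 2 * card R1 + (\<Sum>x\<in>X - R1. cost S T1 x)"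
proof (rule ccontr)
  assume "\<not> ?thesis"
  then have "barrier S T1 R1 (\<lambda>_. undefined :: 'c)"
    using assms ST unfolding barrier_def by auto
  then have "card T + card R \<le> card T1 + card R1" by (rule minimal)
  moreover have "card T1 \<le> card T" "card R1 \<le> card R" using assms fin by (auto intro: card_mono)
  moreover have "card T1 < card T \<or> card R1 < card R"
    using assms fin by (metis psubset_card_mono psubsetI)
  ultimately show False by linarith
qed

section \<open>Selections and their excess\<close>

definition selection :: "('x \<Rightarrow> 'y set) \<Rightarrow> bool" where
  "selection p \<longleftrightarrow> (\<forall>x\<in>X. p x \<subseteq> N x \<inter> T \<and> card (p x) = min 2 (cost S T x))"

definition sdeg :: "('x \<Rightarrow> 'y set) \<Rightarrow> 'y \<Rightarrow> nat" where
  "sdeg p t = card {x \<in> X. t \<in> p x}"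

definition excess :: "('x \<Rightarrow> 'y set) \<Rightarrow> nat" where
  "excess p = (\<Sum>t\<in>T. sdeg p t - k)"

definition swap_rel :: "('x \<Rightarrow> 'y set) \<Rightarrow> 'y rel" where
  "swap_rel p = {(t, s). \<exists>x\<in>X. t \<in> p x \<and> s \<in> N x \<inter> T - p x}"

lemma selection_exists: "\<exists>p. selection p"
proof -
  have "\<exists>A. A \<subseteq> N x \<inter> T \<and> card A = min 2 (cost S T x)" for x
    using obtain_subset_with_card_n[of "min 2 (cost S T x)" "N x \<inter> T"] cost_le[of T x]
    by (metis min.coboundedI2)
  then show ?thesis unfolding selection_def by metis
qed

definition bad_path :: "('x \<Rightarrow> 'y set) \<Rightarrow> nat \<Rightarrow> (nat \<Rightarrow> 'y) \<Rightarrow> (nat \<Rightarrow> 'x) \<Rightarrow> bool" where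
  "bad_path p m a e \<longleftrightarrow> selection p \<and> (\<forall>p'. selection p' \<longrightarrow> excess p \<le> excess p') \<and>
     a 0 \<in> T \<and> k < sdeg p (a 0) \<and> sdeg p (a m) < k \<and>
     (\<forall>i<m. e i \<in> X \<and> a i \<in> p (e i) \<and> a (Suc i) \<in> N (e i) \<inter> T - p (e i))"

text \<open>
  On a shortest path the first hyperedge does not recur, so swapping along it shortens the path.
\<close>
lemma no_bad_path: "\<not> bad_path p m a e"
proof (induction m arbitrary: p a e rule: less_induct)
  case (less m)
  show ?case
  proof
    assume bad: "bad_path p m a e"
    then have sel: "selection p" and opt: "\<And>p'. selection p' \<Longrightarrow> excess p \<le> excess p'"
      and a0: "a 0 \<in> T" "k < sdeg p (a 0)" and am: "sdeg p (a m) < k"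
      and path: "\<And>i. i < m \<Longrightarrow> e i \<in> X \<and> a i \<in> p (e i) \<and> a (Suc i) \<in> N (e i) \<inter> T - p (e i)"
      unfolding bad_path_def by blast+
    have m: "m > 0" using a0 am by (cases m) auto
    have e_ne: "e j \<noteq> e 0" if j: "0 < j" "j < m" for j
    proof
      assume eq: "e j = e 0"
      have "bad_path p (m - j) (\<lambda>i. if i = 0 then a 0 else a (i + j)) (\<lambda>i. if i = 0 then e 0 else e (i + j))"
        unfolding bad_path_def
      proof (intro conjI allI impI)
        fix i assume i: "i < m - j"
        show "(if i = 0 then e 0 else e (i + j)) \<in> X" using path[of "i + j"] path[of 0] i m by simp
        show "(if i = 0 then a 0 else a (i + j)) \<in> p (if i = 0 then e 0 else e (i + j))"
          using path[of "i + j"] path[of 0] i m by simp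
        show "(if Suc i = 0 then a 0 else a (Suc i + j)) \<in>
            N (if i = 0 then e 0 else e (i + j)) \<inter> T - p (if i = 0 then e 0 else e (i + j))"
        proof (cases "i = 0")
          case True
          then show ?thesis using path[OF j(2)] unfolding eq by simp
        next
          case False
          then show ?thesis using path[of "i + j"] i by simp
        qed
      next
        show "k < sdeg p (if 0 = (0::nat) then a 0 else a (0 + j))" using a0 by simp
        show "(if 0 = (0::nat) then a 0 else a (0 + j)) \<in> T" using a0 by simp
        have "m - j + j = m" "m - j \<noteq> 0" using j by auto
        then show "sdeg p (if m - j = 0 then a 0 else a (m - j + j)) < k" using am by simp
      qed (fact sel opt)+
      then show False using less[of "m - j"] j by simp
    qed
    let ?x = "e 0" and ?t = "a 0" and ?s = "a 1"
    have x: "?x \<in> X" "?t \<in> p ?x" "?s \<in> N ?x" "?s \<in> T" "?s \<notin> p ?x" using path[OF m] by auto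
    have ts: "?t \<noteq> ?s" using x by auto
    define p' where "p' = p(?x := insert ?s (p ?x - {?t}))"
    have fp: "finite (p ?x)" using sel x finite_N[OF x(1)] unfolding selection_def by (meson finite_Int finite_subset)
    have card_p': "card (insert ?s (p ?x - {?t})) = card (p ?x)"
      using x fp card_Suc_Diff1[OF fp x(2)] by simp
    have sel': "selection p'"
      using sel x card_p' unfolding selection_def p'_def by auto
    have "{y \<in> X. ?t \<in> p y} = insert ?x {y \<in> X. ?t \<in> p' y}" "?x \<notin> {y \<in> X. ?t \<in> p' y}"
      using x ts by (auto simp: p'_def)
    then have dt: "sdeg p ?t = Suc (sdeg p' ?t)" unfolding sdeg_def using finite_X by simp
    have "{y \<in> X. ?s \<in> p' y} = insert ?x {y \<in> X. ?s \<in> p y}" "?x \<notin> {y \<in> X. ?s \<in> p y}"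
      using x ts by (auto simp: p'_def)
    then have ds: "sdeg p' ?s = Suc (sdeg p ?s)" unfolding sdeg_def using finite_X by simp
    have do: "sdeg p' u = sdeg p u" if "u \<noteq> ?t" "u \<noteq> ?s" for u
    proof -
      have "{y \<in> X. u \<in> p' y} = {y \<in> X. u \<in> p y}" using that by (auto simp: p'_def)
      then show ?thesis by (simp add: sdeg_def)
    qed
    have split: "(\<Sum>t\<in>T. sdeg f t - k) = (sdeg f ?t - k) + ((sdeg f ?s - k) + (\<Sum>t\<in>T - {?t} - {?s}. sdeg f t - k))" for f
    proof -
      have s: "?s \<in> T - {?t}" using x ts by simp
      show ?thesis unfolding sum.remove[OF fin(2) a0(1)] sum.remove[OF finite_Diff[OF fin(2)] s] by (rule refl)
    qed
    have rest: "(\<Sum>t\<in>T - {?t} - {?s}. sdeg p' t - k) = (\<Sum>t\<in>T - {?t} - {?s}. sdeg p t - k)"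
      using do by (intro sum.cong) auto
    have le: "excess p \<le> excess p'" using opt sel' .
    \<comment> \<open>If \<open>a 1\<close> were below \<open>k\<close>, the swap alone would lower
      the excess, against optimality. So the swap is neutral and makes \<open>a 1\<close> the
      overloaded start of the shorter path.\<close>
    have ks: "k \<le> sdeg p ?s"
    proof (rule ccontr)
      assume "\<not> ?thesis"
      then have "excess p' < excess p" unfolding excess_def split rest using dt ds a0 by simp
      then show False using le by simp
    qed
    then have "excess p' = excess p" unfolding excess_def split rest using dt ds a0 by simp
    then have opt': "\<And>f. selection f \<Longrightarrow> excess p' \<le> excess f" using opt by simp
    have "a m \<noteq> ?s" "a m \<noteq> ?t" using ks am a0 by auto
    have "bad_path p' (m - 1) (\<lambda>i. a (Suc i)) (\<lambda>i. e (Suc i))"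
      unfolding bad_path_def
    proof (intro conjI allI impI)
      show "sdeg p' (a (Suc (m - 1))) < k" using do am m \<open>a m \<noteq> ?s\<close> \<open>a m \<noteq> ?t\<close> by simp
      fix i assume i: "i < m - 1"
      then have "p' (e (Suc i)) = p (e (Suc i))" using e_ne[of "Suc i"] by (simp add: p'_def)
      then show "e (Suc i) \<in> X" "a (Suc i) \<in> p' (e (Suc i))"
        "a (Suc (Suc i)) \<in> N (e (Suc i)) \<inter> T - p' (e (Suc i))"
        using path[of "Suc i"] i by auto
    qed (use sel' opt' x ds ks in simp_all)
    then show False using less[of "m - 1"] m by simp
  qed
qed

text \<open>\<open>T3\<close> is everything that surplus can reach by swaps from overloaded
  vertices. A vertex of degree below \<open>k\<close> in it would complete a bad path.\<close>

lemma closed_selection: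
  obtains p T3 where "selection p" "T3 \<subseteq> T" "\<And>t. t \<in> T \<Longrightarrow> k < sdeg p t \<Longrightarrow> t \<in> T3"
    "\<And>t. t \<in> T3 \<Longrightarrow> k \<le> sdeg p t"
    "\<And>x. x \<in> X \<Longrightarrow> p x \<inter> T3 \<noteq> {} \<Longrightarrow> N x \<inter> T - p x \<subseteq> T3"
proof -
  obtain p where p: "selection p" "\<And>p'. selection p' \<Longrightarrow> excess p \<le> excess p'"
    using selection_exists ex_has_least_nat[of selection _ excess] by metis
  define T3 where "T3 = (swap_rel p)\<^sup>* `` {t \<in> T. k < sdeg p t}"
  show thesis
  proof (rule that[of p T3])
    show "T3 \<subseteq> T"
    proof
      fix s assume "s \<in> T3"
      then obtain t where "t \<in> T" "(t, s) \<in> (swap_rel p)\<^sup>*" unfolding T3_def by blast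
      from this(2) show "s \<in> T" using \<open>t \<in> T\<close> by (cases rule: rtranclE) (auto simp: swap_rel_def)
    qed
    show "N x \<inter> T - p x \<subseteq> T3" if x: "x \<in> X" "p x \<inter> T3 \<noteq> {}" for x
    proof
      fix s assume s: "s \<in> N x \<inter> T - p x"
      obtain t where t: "t \<in> p x" "t \<in> T3" using x by blast
      then have "(t, s) \<in> swap_rel p" using s x by (auto simp: swap_rel_def)
      then show "s \<in> T3" using t unfolding T3_def by (auto intro: rtrancl_into_rtrancl)
    qed
    show "k \<le> sdeg p s" if "s \<in> T3" for s
    proof (rule ccontr)
      assume ns: "\<not> ?thesis"
      obtain t where t: "t \<in> T" "k < sdeg p t" "(t, s) \<in> (swap_rel p)\<^sup>*"
        using \<open>s \<in> T3\<close> unfolding T3_def by blast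
      then obtain m where "(t, s) \<in> swap_rel p ^^ m" using rtrancl_imp_relpow by blast
      then obtain a where a: "a 0 = t" "a m = s" "\<forall>i<m. (a i, a (Suc i)) \<in> swap_rel p"
        unfolding relpow_fun_conv by blast
      then have "\<forall>i. \<exists>x. i < m \<longrightarrow> x \<in> X \<and> a i \<in> p x \<and> a (Suc i) \<in> N x \<inter> T - p x"
        unfolding swap_rel_def by blast
      then obtain e where "\<forall>i. i < m \<longrightarrow> e i \<in> X \<and> a i \<in> p (e i) \<and> a (Suc i) \<in> N (e i) \<inter> T - p (e i)"
        by metis
      then have "bad_path p m a e" unfolding bad_path_def using p t a ns by simp
      then show False using no_bad_path by blast
    qed
  qed (use p in \<open>auto simp: T3_def\<close>)
qed

lemma sum_sdeg:
  assumes "selection p" "T1 \<subseteq> T"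
  shows "(\<Sum>t\<in>T1. sdeg p t) = (\<Sum>x\<in>X. card (p x \<inter> T1))"
  using sum_card_incidences[of T1 X p] assms ST by (auto simp: sdeg_def selection_def)

lemma sum_if_R:
  assumes "R1 \<subseteq> R" shows "(\<Sum>x\<in>X. if x \<in> R1 then 2 else f x) = 2 * card R1 + (\<Sum>x\<in>X - R1. f x :: nat)"
proof -
  have "R1 \<subseteq> X" "finite R1" using assms ST fin finite_subset by auto
  then have "X \<inter> {x. x \<in> R1} = R1" "X \<inter> - {x. x \<in> R1} = X - R1" by auto
  then show ?thesis using sum.If_cases[OF finite_X, of "\<lambda>x. x \<in> R1" "\<lambda>_. 2" f] by simp
qed

lemma sum_deficit:
  "(\<Sum>x\<in>X. if x \<in> R then f x else 0) = (\<Sum>x\<in>R. f x :: nat)"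
  using ST finite_X by (simp add: sum.If_cases Int_absorb1)

text \<open>A selection uses at most the cost of a hyperedge outside \<open>R\<close>, and at most
  the 2 charged for one in \<open>R\<close>; the sum over \<open>R\<close> is what is left of the
  latter.\<close>

lemma selection_bound:
  assumes "selection p"
  shows "k * card S + (\<Sum>x\<in>R. 2 - card (p x)) + (\<Sum>t\<in>T. sdeg p t) + 2
    \<le> k * card T + card (odd_classes S T R l)"
proof -
  have "(\<Sum>x\<in>X. card (p x \<inter> T) + (if x \<in> R then 2 - card (p x) else 0))
      \<le> (\<Sum>x\<in>X. if x \<in> R then 2 else cost S T x)"
  proof (rule sum_mono)
    fix x assume "x \<in> X"
    then have "p x \<inter> T = p x" "card (p x) = min 2 (cost S T x)" using assms by (auto simp: selection_def)
    then show "card (p x \<inter> T) + (if x \<in> R then 2 - card (p x) else 0) \<le> (if x \<in> R then 2 else cost S T x)"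
      by auto
  qed
  then show ?thesis using barrier_slack
    unfolding sum_if_R[OF order_refl] sum.distrib sum_deficit sum_sdeg[OF assms order_refl] by linarith
qed

lemma excess_bound:
  assumes "selection p" "T3 \<subseteq> T" and T3: "\<And>t. t \<in> T \<Longrightarrow> k < sdeg p t \<Longrightarrow> t \<in> T3"
    "\<And>t. t \<in> T3 \<Longrightarrow> k \<le> sdeg p t"
    "\<And>x. x \<in> X \<Longrightarrow> p x \<inter> T3 \<noteq> {} \<Longrightarrow> N x \<inter> T - p x \<subseteq> T3"
    and pos: "0 < (\<Sum>x\<in>R. 2 - card (p x)) + excess p"
  shows "(\<Sum>x\<in>R. 2 - card (p x)) + excess p + 2 \<le> card (odd_classes S T R l)"
proof -
  define T1 where "T1 = T - T3"
  \<comment> \<open>A hyperedge of \<open>R\<close> stays outside \<open>R1\<close> if fewer than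
    two of its selected vertices lie in \<open>T1\<close>; by \<open>c1\<close> its cost over
    \<open>T1\<close> is then at most the number of these.\<close>
  define R1 where "R1 = {x \<in> R. card (p x \<inter> T1) = 2}"
  have p: "p x \<subseteq> N x \<inter> T" "card (p x) = min 2 (cost S T x)" "finite (p x)" if "x \<in> X" for x
    using assms(1) that finite_N[OF that] unfolding selection_def by (auto intro: finite_subset)
  have p_split: "card (p x) = card (p x \<inter> T1) + card (p x \<inter> T3)" if "x \<in> X" for x
  proof -
    have "p x = (p x \<inter> T1) \<union> (p x \<inter> T3)" using p(1)[OF that] by (auto simp: T1_def)
    moreover have "(p x \<inter> T1) \<inter> (p x \<inter> T3) = {}" by (auto simp: T1_def)
    ultimately show ?thesis using p(3)[OF that] by (metis card_Un_disjoint finite_Int)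
  qed
  have T1: "T1 \<subseteq> T" and R1: "R1 \<subseteq> R" by (auto simp: T1_def R1_def)
  have ne: "T1 \<noteq> T \<or> R1 \<noteq> R"
  proof (cases "excess p = 0")
    case False
    then obtain t where "t \<in> T" "k < sdeg p t" unfolding excess_def by (auto simp: sum_eq_0_iff fin)
    then have "t \<in> T3" using T3 by blast
    then show ?thesis using \<open>t \<in> T\<close> by (auto simp: T1_def)
  next
    case True
    then have "(\<Sum>x\<in>R. 2 - card (p x)) \<noteq> 0" using pos by simp
    then obtain x where "x \<in> R" "2 - card (p x) \<noteq> 0" by (rule sum.not_neutral_contains_not_neutral)
    then have "x \<in> R" "card (p x) < 2" by auto
    moreover have "card (p x \<inter> T1) \<le> card (p x)" using p \<open>x \<in> R\<close> ST by (intro card_mono) auto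
    ultimately have "x \<in> R" "x \<notin> R1" by (simp_all add: R1_def)
    then show ?thesis by blast
  qed
  have c1: "cost S T1 x \<le> card (p x \<inter> T1)" if "x \<in> X" "p x \<inter> T3 \<noteq> {} \<or> card (p x) < 2" for x
  proof (cases "p x \<inter> T3 = {}")
    case True
    then have "card (p x \<inter> T1) = card (p x)" "card (p x) = cost S T x"
      using p_split[OF that(1)] p[OF that(1)] that by auto
    then show ?thesis using cost_mono[OF T1] by simp
  next
    case False
    then have "N x \<inter> T1 = p x \<inter> T1" using T3(3)[OF that(1)] p(1)[OF that(1)] by (auto simp: T1_def)
    then show ?thesis using cost_le[of T1 x] by simp
  qed
  have "(\<Sum>x\<in>X. (if x \<in> R1 then 2 else cost S T1 x) + (card (p x \<inter> T3) + (if x \<in> R then 2 - card (p x) else 0)))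
      \<le> (\<Sum>x\<in>X. if x \<in> R then 2 else cost S T x)"
  proof (rule sum_mono)
    fix x assume x: "x \<in> X"
    have c2: "card (p x) \<le> 2" "card (p x) \<le> cost S T x" using p(2)[OF x] by auto
    consider "x \<in> R1" | "x \<in> R - R1" | "x \<notin> R" "p x \<inter> T3 = {}" | "x \<notin> R" "p x \<inter> T3 \<noteq> {}" by blast
    then show "(if x \<in> R1 then 2 else cost S T1 x) + (card (p x \<inter> T3) + (if x \<in> R then 2 - card (p x) else 0))
        \<le> (if x \<in> R then 2 else cost S T x)"
    proof cases
      case 1
      then show ?thesis using R1 p_split[OF x] c2 by (auto simp: R1_def)
    next
      case 2
      then have "card (p x \<inter> T1) \<noteq> 2" by (auto simp: R1_def)
      then have "card (p x \<inter> T1) < 2" using p_split[OF x] c2 by linarith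
      then have "p x \<inter> T3 \<noteq> {} \<or> card (p x) < 2" using p_split[OF x] by auto
      then show ?thesis using c1[OF x] 2 p_split[OF x] c2 by simp
    next
      case 3
      then show ?thesis using cost_mono[OF T1] R1 by auto
    next
      case 4
      then show ?thesis using c1[OF x] R1 p_split[OF x] c2 by auto
    qed
  qed
  then have "2 * card R1 + (\<Sum>x\<in>X - R1. cost S T1 x) + (\<Sum>t\<in>T3. sdeg p t) + (\<Sum>x\<in>R. 2 - card (p x))
      \<le> 2 * card R + (\<Sum>x\<in>X - R. cost S T x)"
    unfolding sum.distrib sum_if_R[OF order_refl] sum_if_R[OF R1] sum_deficit sum_sdeg[OF assms(1,2)] by linarith
  moreover have "k * card T = k * card T1 + k * card T3"
  proof -
    have "card T = card T1 + card T3"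
      unfolding T1_def using assms(2) fin by (metis card_Diff_subset card_mono finite_subset le_add_diff_inverse2)
    then show ?thesis by (simp add: distrib_left)
  qed
  moreover have "(\<Sum>t\<in>T3. sdeg p t) = excess p + k * card T3"
  proof -
    have "(\<Sum>t\<in>T3. sdeg p t) = (\<Sum>t\<in>T3. (sdeg p t - k) + k)" using T3(2) by (intro sum.cong) auto
    also have "\<dots> = (\<Sum>t\<in>T3. sdeg p t - k) + k * card T3" by (simp add: sum.distrib)
    also have "(\<Sum>t\<in>T3. sdeg p t - k) = excess p"
      unfolding excess_def
    proof (rule sum.mono_neutral_left)
      show "\<forall>t\<in>T - T3. sdeg p t - k = 0" using T3(1) by (meson DiffD1 DiffD2 diff_is_0_eq leI)
    qed (use assms(2) fin in auto)
    finally show ?thesis .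
  qed
  ultimately show ?thesis using barrier_slack smaller_not_barrier[OF T1 R1 ne] by linarith
qed

end

section \<open>Small cutsets from a minimal barrier\<close>

text \<open>A heaviest vertex is taken and its neighbours are discarded; none of them weighs more,
  so the weight removed is at most \<open>1 + degree\<close> times the weight of the chosen vertex.
  Degrees in the remaining set only grow when measured in \<open>A\<close>.\<close>

lemma greedy_independent_set:
  fixes w :: "'a \<Rightarrow> nat"
  assumes "finite A" and sym: "\<And>s t. adj s t \<Longrightarrow> adj t s" and irr: "\<And>t. \<not> adj t t"
  shows "\<exists>I\<subseteq>A. (\<forall>s\<in>I. \<forall>t\<in>I. \<not> adj s t) \<and>
    sum w A \<le> (\<Sum>t\<in>I. (1 + card {s \<in> A. adj t s}) * w t) \<and>
    card A \<le> (\<Sum>t\<in>I. 1 + card {s \<in> A. adj t s})"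
  using assms(1)
proof (induction A rule: finite_psubset_induct)
  case (psubset A)
  show ?case
  proof (cases "A = {}")
    case False
    then have "Max (w ` A) \<in> w ` A" using psubset.hyps by (intro Max_in) auto
    then obtain t where t: "t \<in> A" "w t = Max (w ` A)" by auto
    have max: "w s \<le> w t" if "s \<in> A" for s using t that psubset.hyps by auto
    let ?B = "A - insert t {s \<in> A. adj t s}"
    have "?B \<subset> A" using t by auto
    from psubset.IH[OF this] obtain I where I: "I \<subseteq> ?B" "\<forall>s\<in>I. \<forall>t\<in>I. \<not> adj s t"
      "sum w ?B \<le> (\<Sum>u\<in>I. (1 + card {s \<in> ?B. adj u s}) * w u)"
      "card ?B \<le> (\<Sum>u\<in>I. 1 + card {s \<in> ?B. adj u s})" by blast
    have finI: "finite I" "t \<notin> I" using finite_subset[OF I(1)] I psubset.hyps by auto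
    have ins: "(\<Sum>u\<in>insert t I. f u) = f t + (\<Sum>u\<in>I. f u)" for f :: "'a \<Rightarrow> nat" using finI by simp
    have le: "card {s \<in> ?B. adj u s} \<le> card {s \<in> A. adj u s}" for u
      using psubset.hyps by (intro card_mono) auto
    have "(\<Sum>u\<in>I. (1 + card {s \<in> ?B. adj u s}) * w u) \<le> (\<Sum>u\<in>I. (1 + card {s \<in> A. adj u s}) * w u)"
      using le by (intro sum_mono mult_right_mono) auto
    moreover have "(\<Sum>u\<in>I. 1 + card {s \<in> ?B. adj u s}) \<le> (\<Sum>u\<in>I. 1 + card {s \<in> A. adj u s})"
      using le by (intro sum_mono) auto
    moreover have "sum w A = sum w ?B + sum w (insert t {s \<in> A. adj t s})"
      using t psubset.hyps by (intro sum.subset_diff) auto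
    moreover have "sum w (insert t {s \<in> A. adj t s}) \<le> (1 + card {s \<in> A. adj t s}) * w t"
    proof -
      have "w s \<le> w t" if "s \<in> insert t {s \<in> A. adj t s}" for s using max t(1) that by blast
      from sum_bounded_above[of "insert t {s \<in> A. adj t s}", OF this]
      have "sum w (insert t {s \<in> A. adj t s}) \<le> card (insert t {s \<in> A. adj t s}) * w t" by simp
      then show ?thesis using irr psubset.hyps by simp
    qed
    moreover have "card A = card ?B + (1 + card {s \<in> A. adj t s})"
    proof -
      have "card ?B = card A - card (insert t {s \<in> A. adj t s})"
        using t psubset.hyps by (intro card_Diff_subset) auto
      moreover have "card (insert t {s \<in> A. adj t s}) \<le> card A"
        using t psubset.hyps by (intro card_mono) auto
      ultimately show ?thesis using irr psubset.hyps by simp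
    qed
    moreover have "\<not> adj t u" "\<not> adj u t" if "u \<in> I" for u using that I(1) sym[of u t] by blast+
    then have "\<forall>s\<in>insert t I. \<forall>u\<in>insert t I. \<not> adj s u" using I(2) irr by blast
    moreover have "insert t I \<subseteq> A" using I(1) t(1) by blast
    ultimately show ?thesis using I(3,4) by (intro exI[of _ "insert t I"] conjI) (assumption | subst ins, linarith)+
  qed simp
qed

text \<open>\<open>W\<close>, \<open>S\<close>, \<open>T2\<close>, \<open>I\<close>,
  \<open>Dst\<close> are the cardinalities of \<open>W\<close>, \<open>S\<close>,
  \<open>T_high\<close>, \<open>I\<close>, \<open>destroyed\<close>, and \<open>s\<close> counts the
  surviving classes; \<open>E\<close> is the deficit, \<open>g\<close> the excess and
  \<open>A\<close> the greedy bound for the shortfall. After multiplication by \<open>k\<close>, the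
  terms \<open>E\<close> and \<open>g\<close> occur \<open>k\<close> times but are paid for once;
  the last hypothesis, times \<open>k - 1\<close>, pays the remainder.\<close>

lemma cutset_size_arith:
  fixes k :: nat
  assumes "k \<ge> 1" "W + Dst \<le> S + T2 + EM + E" "k * S + E + g + 2 \<le> A + q" "A + k * EM \<le> k * k * I"
    "T2 \<le> g" "q \<le> s + Dst" "0 < E + g \<Longrightarrow> E + g + 2 \<le> q"
  shows "W < k * I + s"
proof -
  obtain j where k: "k = Suc j" using assms(1) by (cases k) auto
  have "k * (W + Dst) \<le> k * (S + T2 + EM + E)" using assms(2) by (rule mult_le_mono2)
  moreover have "k * T2 \<le> k * g" using assms(5) by (rule mult_le_mono2)
  ultimately have 1: "k * W + k * Dst + E + g + 2 \<le> k * k * I + q + k * E + k * g"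
    using assms(3,4) unfolding distrib_left by linarith
  have "k * W < k * k * I + k * s"
  proof (cases "E + g = 0")
    case True
    have "1 * s \<le> k * s" "1 * Dst \<le> k * Dst" using assms(1) by (intro mult_le_mono1, simp)+
    then have "q \<le> k * s + k * Dst" using assms(6) by linarith
    then show ?thesis using 1 True by simp
  next
    case False
    then have "E + g + 2 \<le> q" using assms(7) by simp
    then have "j * (E + g + 2) \<le> j * q" by (rule mult_le_mono2)
    moreover have "k * q \<le> k * (s + Dst)" using assms(6) by (rule mult_le_mono2)
    moreover have "k * q = j * q + q" "k * E = j * E + E" "k * g = j * g + g" by (simp_all add: k)
    ultimately show ?thesis using 1 unfolding distrib_left by linarith
  qed
  then have "k * W < k * (k * I + s)" by (simp only: distrib_left mult.assoc)
  then show ?thesis by simp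
qed

text \<open>\<open>k * k\<close> is the budget of a vertex of degree \<open>d\<close> with
  \<open>e\<close> neighbours and \<open>m\<close> loose hyperedges. At \<open>d = k\<close> the
  weight \<open>k - d\<close> vanishes; otherwise \<open>1 + e \<le> k\<close>, and the products are
  at most \<open>k * (k - d)\<close> and \<open>k * d\<close>.\<close>

lemma local_bound_arith:
  fixes k :: nat
  assumes "e + m \<le> d" "d \<le> k"
  shows "(1 + e) * (k - d) + k * (e + m) \<le> k * k"
proof (cases "d = k")
  case False
  have "(1 + e) * (k - d) \<le> k * (k - d)" using assms False by (intro mult_le_mono1) linarith
  moreover have "k * (e + m) \<le> k * d" using assms by simp
  moreover have "k * (k - d) + k * d = k * k" using assms by (simp flip: distrib_left)
  ultimately show ?thesis by linarith
qed (use assms in simp)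

text \<open>The estimate for the cutset made of \<open>S\<close>, \<open>T\<close> and at most
  \<open>\<rho> = card J0\<close> further vertices, when \<open>I\<close> is a singleton and at
  least \<open>n\<close> classes survive. For \<open>k = 1\<close> the final inequalities are no
  contradiction.\<close>

lemma two_classes_arith:
  fixes k n :: nat
  assumes "k \<ge> 2" "n \<ge> 2" "k * n \<le> S + T + \<rho>" "k * S + E + g + 2 \<le> A + q" "T \<le> g + F"
    "A + k * F \<le> k * k + k" "q \<le> n + \<rho>" "2 * \<rho> \<le> E" "0 < E + g \<Longrightarrow> E + g + 2 \<le> q"
  shows False
proof -
  obtain j where k: "k = Suc (Suc j)" using assms(1) by (metis Suc_le_D numeral_2_eq_2 Suc_le_mono)
  obtain i where n: "n = Suc (Suc i)" using assms(2) by (metis Suc_le_D numeral_2_eq_2 Suc_le_mono)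
  have "k * (k * n) \<le> k * (S + T + \<rho>)" using assms(3) by (rule mult_le_mono2)
  moreover have "k * T \<le> k * (g + F)" using assms(5) by (rule mult_le_mono2)
  ultimately have 1: "k * (k * n) + E + g + 2 \<le> k * k + k + q + k * g + k * \<rho>"
    using assms(4,6) unfolding distrib_left by linarith
  show False
  proof (cases "E + g = 0")
    case True
    then have "k * (k * n) + 2 \<le> k * k + k + n" using 1 assms(7,8) by simp
    then show False by (simp add: k n algebra_simps)
  next
    case False
    then have "E + g + 2 \<le> q" using assms(9) by simp
    define a where "a = Suc j"
    have "a * (E + g + 2) \<le> a * q" using \<open>E + g + 2 \<le> q\<close> by (rule mult_le_mono2)
    moreover have "k * q \<le> k * (n + \<rho>)" using assms(7) by (rule mult_le_mono2)
    moreover have "2 * (k * \<rho>) \<le> k * E" using mult_le_mono2[OF assms(8), of k] by (simp only: mult.left_commute)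
    moreover have "k * q = a * q + q" "k * E = a * E + E" "k * g = a * g + g" "k = a + 1"
      by (simp_all add: k a_def)
    ultimately have "k * (k * n) + k \<le> k * k + k * n" using 1 unfolding distrib_left by linarith
    then show False by (simp add: k n algebra_simps)
  qed
qed

lemma card_group:
  assumes "finite A" "finite B" "f ` A \<subseteq> B"
  shows "card A = (\<Sum>b\<in>B. card {a \<in> A. f a = b})"
  using sum.group[OF assms, of "\<lambda>_. 1::nat"] by simp

section \<open>Toughness in terms of labellings\<close>

context hypergraph
begin

text \<open>A labelling constant on the hyperedges that avoid \<open>W\<close> takes at most as many
  values as there are components, which avoids speaking of components. The label type is fixed,
  since a definition cannot quantify over types; \<open>toughD\<close> passes to any other type by
  an injection of the finitely many labels.\<close>

definition tough :: bool where
  "tough \<longleftrightarrow> (\<forall>W (h :: 'y \<Rightarrow> nat). W \<subseteq> Y \<longrightarrow>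
     (\<forall>x\<in>X. N x \<inter> W = {} \<longrightarrow> (\<forall>y\<in>N x. \<forall>z\<in>N x. h y = h z)) \<longrightarrow>
     2 \<le> card (h ` (Y - W)) \<longrightarrow> k * card (h ` (Y - W)) \<le> card W)"

lemma toughD:
  fixes h :: "'y \<Rightarrow> 'd"
  assumes tough "W \<subseteq> Y"
    and "\<And>x y z. \<lbrakk>x \<in> X; N x \<inter> W = {}; y \<in> N x; z \<in> N x\<rbrakk> \<Longrightarrow> h y = h z"
    and "n \<le> card (h ` (Y - W))" "2 \<le> n"
  shows "k * n \<le> card W"
proof -
  have "finite (h ` (Y - W))" using finite_Y by simp
  then obtain f :: "'d \<Rightarrow> nat" where f: "inj_on f (h ` (Y - W))"
    using finite_imp_inj_to_nat_seg[of "h ` (Y - W)"] by auto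
  have c: "card ((f \<circ> h) ` (Y - W)) = card (h ` (Y - W))"
    using card_image[OF f] by (simp add: image_comp)
  have "\<forall>x\<in>X. N x \<inter> W = {} \<longrightarrow> (\<forall>y\<in>N x. \<forall>z\<in>N x. (f \<circ> h) y = (f \<circ> h) z)"
    by (auto intro: arg_cong[OF assms(3)])
  moreover have "2 \<le> card ((f \<circ> h) ` (Y - W))" using c assms by simp
  ultimately have "k * card ((f \<circ> h) ` (Y - W)) \<le> card W"
    using assms(1,2) unfolding tough_def by blast
  then have "k * card (h ` (Y - W)) \<le> card W" by (simp only: c)
  then show ?thesis using assms(4) by (meson le_trans mult_le_mono2)
qed

end

section \<open>Construction of the cutset\<close>

locale tough_barrier = minimal_barrier X Y N k S T R l
  for X :: "'x set" and Y :: "'y set" and N k and S T :: "'y set" and R :: "'x set" and l :: "'y \<Rightarrow> 'c" +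
  fixes p :: "'x \<Rightarrow> 'y set" and T3 I :: "'y set"
  assumes toughness: tough and N_nonempty: "x \<in> X \<Longrightarrow> N x \<noteq> {}" and k_pos: "k \<ge> 1"
    and sel: "selection p" and T3: "T3 \<subseteq> T" "\<And>t. t \<in> T \<Longrightarrow> k < sdeg p t \<Longrightarrow> t \<in> T3"
    "\<And>t. t \<in> T3 \<Longrightarrow> k \<le> sdeg p t"
    "\<And>x. x \<in> X \<Longrightarrow> p x \<inter> T3 \<noteq> {} \<Longrightarrow> N x \<inter> T - p x \<subseteq> T3"
    and I_sub: "I \<subseteq> {t \<in> T. sdeg p t \<le> k}"
    and I_indep: "\<And>s t x. s \<in> I \<Longrightarrow> t \<in> I \<Longrightarrow> s \<noteq> t \<Longrightarrow> x \<in> X \<Longrightarrow> p x \<noteq> {s, t}"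
begin

abbreviation "d \<equiv> sdeg p"
definition "U = Y - S - T"
definition "T_high = {t \<in> T. k < d t}"
definition "T_low = {t \<in> T. d t \<le> k}"
definition "J1 = {x \<in> X. N x \<inter> U \<noteq> {} \<and> (\<exists>t\<in>I. p x = {t})}"
text \<open>Hyperedges of \<open>R\<close> are exempt from the label condition and may join several
  classes. One that selects nothing is not cut by the deletion of vertices of \<open>T\<close>, so
  it needs a vertex of its own.\<close>

definition "J0 = {x \<in> R. N x \<inter> U \<noteq> {} \<and> p x = {}}"
definition "J = J0 \<union> J1"
definition "v x = (SOME y. y \<in> N x \<inter> U)"
definition "class c = {y \<in> U. l y = c}"
definition "destroyed = {c \<in> l ` U. class c \<subseteq> v ` J}"
text \<open>
  In a nice class one vertex can be kept: a single hyperedge joins it to one vertex of \<open>I\<close>, and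
  nothing else.
\<close>
definition "nice = {c \<in> destroyed. (\<forall>x\<in>J. l (v x) = c \<longrightarrow> x \<notin> R) \<and> inj_on v {x \<in> J. l (v x) = c}}"
definition "rep c = (SOME y. y \<in> class c)"
text \<open>A spared vertex hangs on a vertex of \<open>I\<close> and forms no component of its own,
  so a nice class still counts as destroyed.\<close>

definition "spared = rep ` nice"
definition "W = S \<union> T_high \<union> (T_low - I) \<union> (v ` J - spared)"
definition "nbr_count t = card {s \<in> T_low. s \<noteq> t \<and> (\<exists>x\<in>X. p x = {t, s})}"
definition "loose_count t = card {x \<in> X. N x \<inter> U \<noteq> {} \<and> p x = {t}}"
definition "deficit = (\<Sum>x\<in>R. 2 - card (p x))"

lemma p_sub: "x \<in> X \<Longrightarrow> p x \<subseteq> N x \<inter> T" and p_card: "x \<in> X \<Longrightarrow> card (p x) = min 2 (cost S T x)"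
  using sel by (auto simp: selection_def)

lemma fin': "finite U" "finite T_high" "finite T_low" "finite J0" "finite J1" "finite J" "finite I"
  "finite destroyed" "J \<subseteq> X" "finite nice" "finite spared"
proof -
  show "finite U" using finite_Y by (simp add: U_def)
  show "finite T_high" "finite T_low" using fin by (auto simp: T_high_def T_low_def)
  show "finite J0" "finite J1" "finite J" using fin finite_X by (auto simp: J0_def J1_def J_def)
  show "finite I" using finite_subset[OF I_sub] fin by simp
  show "J \<subseteq> X" using ST by (auto simp: J_def J0_def J1_def)
  show "finite destroyed" using \<open>finite U\<close> by (simp add: destroyed_def)
  then show "finite nice" by (simp add: nice_def)
  then show "finite spared" by (simp add: spared_def)
qed

lemma v_in: "x \<in> J \<Longrightarrow> v x \<in> N x \<inter> U"
  unfolding v_def by (rule someI_ex) (auto simp: J_def J0_def J1_def)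

lemma rep_in: "c \<in> nice \<Longrightarrow> rep c \<in> U \<and> l (rep c) = c"
proof -
  assume "c \<in> nice"
  then have "\<exists>y. y \<in> class c" by (auto simp: nice_def destroyed_def class_def)
  then have "rep c \<in> class c" unfolding rep_def by (rule someI_ex)
  then show ?thesis by (simp add: class_def)
qed

lemma spared_iff: "y \<in> spared \<longleftrightarrow> y \<in> U \<and> l y \<in> nice \<and> y = rep (l y)"
  unfolding spared_def using rep_in by auto

lemma spared_sub: "spared \<subseteq> v ` J"
proof
  fix y assume "y \<in> spared"
  then have "l y \<in> destroyed" "y \<in> class (l y)" by (auto simp: spared_iff nice_def class_def)
  then show "y \<in> v ` J" by (auto simp: destroyed_def)
qed

lemma W_sub: "W \<subseteq> Y"
  using ST v_in by (auto simp: W_def T_high_def T_low_def U_def)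

lemma T_split: "T = T_high \<union> T_low" "T_high \<inter> T_low = {}"
  by (auto simp: T_high_def T_low_def)

lemma spared_unique:
  assumes "y \<in> U - (v ` J - spared)" "l y = l z" "z \<in> spared"
  shows "y = z"
proof -
  have "l z \<in> destroyed" using assms by (auto simp: spared_iff nice_def)
  then have "y \<in> v ` J" using assms by (auto simp: destroyed_def class_def)
  then have "y \<in> spared" using assms by blast
  then show ?thesis using assms by (metis spared_iff)
qed

text \<open>For a spared \<open>y\<close> the value \<open>t\<close> exists and is unique: the class
  of \<open>y\<close> has no hyperedge of \<open>R\<close>, hence only hyperedges of
  \<open>J1\<close>, and \<open>v\<close> is injective on them.\<close>

definition "host y = (SOME t. \<exists>x\<in>J. v x = y \<and> p x = {t})"
definition "lab y = (if y \<in> I then Inl y else if y \<in> spared then Inl (host y) else Inr (l y))"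

text \<open>A hyperedge avoiding \<open>W\<close> meets \<open>T\<close> only in \<open>I\<close>.
  With two vertices there, it selects a pair in \<open>I\<close>, against independence. With one
  vertex \<open>t\<close> and some of \<open>U\<close>, it is in \<open>J1\<close> and avoids
  \<open>W\<close> only because \<open>v x\<close> is spared and hangs on \<open>t\<close>. With
  none it lies in a single class, unless it belongs to \<open>R\<close>; but then it is in
  \<open>J0\<close>, and \<open>v x\<close> is in \<open>W\<close> because nice classes have no such
  hyperedge.\<close>

lemma lab_const:
  assumes x: "x \<in> X" "N x \<inter> W = {}" and yz: "y \<in> N x" "z \<in> N x"
  shows "lab y = lab z"
proof -
  have IT: "I \<subseteq> T" "I \<subseteq> T_low" using I_sub by (auto simp: T_low_def)
  have N: "N x \<subseteq> I \<union> (U - (v ` J - spared))" "N x \<inter> S = {}"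
    using x N_subset T_split by (auto simp: W_def U_def)
  then have NT: "N x \<inter> T \<subseteq> I" by (auto simp: U_def)
  have vspared: "v x \<in> spared" "l (v x) \<in> nice" "x \<notin> R" if xJ: "x \<in> J"
  proof -
    show 1: "v x \<in> spared" using v_in[OF xJ] xJ x by (auto simp: W_def)
    then show 2: "l (v x) \<in> nice" by (simp add: spared_iff)
    show "x \<notin> R" using 2 xJ by (auto simp: nice_def)
  qed
  have U_not_I: "u \<notin> I" if "u \<in> U" for u using that IT by (auto simp: U_def)
  consider "card (N x \<inter> T) = 0" | "card (N x \<inter> T) = 1" | "card (N x \<inter> T) \<ge> 2" by linarith
  then show ?thesis
  proof cases
    case 1
    then have NT0: "N x \<inter> T = {}" using fin by simp
    then have NU: "N x \<subseteq> U" using N_subset x(1) N by (auto simp: U_def)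
    have "p x = {}" using p_sub[OF x(1)] NT0 by blast
    have "x \<notin> R"
    proof
      assume "x \<in> R"
      then have "x \<in> J" using \<open>p x = {}\<close> NU N_nonempty[OF x(1)] by (auto simp: J_def J0_def)
      then show False using vspared \<open>x \<in> R\<close> by blast
    qed
    then have "l y = l z" using label_eq[of x y z] x yz NU by (auto simp: U_def)
    moreover have "y \<in> U - (v ` J - spared)" "z \<in> U - (v ` J - spared)"
      using N yz NU U_not_I by blast+
    ultimately have "y = z \<or> y \<notin> spared \<and> z \<notin> spared"
      using spared_unique[of y z] spared_unique[of z y] by metis
    moreover have "y \<notin> I" "z \<notin> I" using yz NU U_not_I by blast+
    ultimately show ?thesis using \<open>l y = l z\<close> unfolding lab_def by auto
  next
    case 2
    then obtain t where t: "N x \<inter> T = {t}" by (rule card_1_singletonE)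
    then have tI: "t \<in> I" using NT by blast
    show ?thesis
    proof (cases "N x \<inter> U = {}")
      case True
      then have "N x \<subseteq> {t}" using t N_subset[OF x(1)] N by (auto simp: U_def)
      then have "y = z" using yz by auto
      then show ?thesis by simp
    next
      case False
      then have "cost S T x = 1" using t by (auto simp: cost_def U_def)
      then have "card (p x) = 1" using p_card[OF x(1)] by simp
      then have px: "p x = {t}" using p_sub[OF x(1)] t by (metis card_1_singletonE insert_not_empty subset_singletonD)
      then have xJ: "x \<in> J" using False tI x by (auto simp: J_def J1_def)
      have sp: "v x \<in> spared" "l (v x) \<in> nice" "x \<notin> R" using vspared[OF xJ] by auto
      have vx: "v x \<in> N x" "v x \<in> U" using v_in[OF xJ] by auto
      have only: "u = v x" if "u \<in> N x" "u \<noteq> t" for u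
      proof -
        have "u \<notin> T" using that t by blast
        then have uU: "u \<in> U" using that N N_subset[OF x(1)] by (auto simp: U_def)
        then have "l u = l (v x)" using label_eq[of x u "v x"] x sp vx that by (auto simp: U_def)
        moreover have "u \<in> U - (v ` J - spared)" using N that U_not_I uU by blast
        ultimately show ?thesis using spared_unique sp by blast
      qed
      have "host (v x) = t"
      proof -
        have uniq: "x' = x" if "x' \<in> J" "v x' = v x" for x'
        proof -
          have "inj_on v {x' \<in> J. l (v x') = l (v x)}" using sp(2) by (simp add: nice_def)
          from inj_onD[OF this that(2)] show ?thesis using that xJ by simp
        qed
        have "\<exists>x'\<in>J. v x' = v x \<and> p x' = {host (v x)}"
          unfolding host_def by (rule someI_ex) (use xJ px in blast)
        then show ?thesis using uniq px by auto
      qed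
      then have "lab u = Inl t" if "u \<in> N x" for u
        using only[OF that] tI sp(1) U_not_I[OF vx(2)] by (cases "u = t") (auto simp: lab_def)
      then show ?thesis using yz by metis
    qed
  next
    case 3
    then have "cost S T x \<ge> 2" by (auto simp: cost_def)
    then have "card (p x) = 2" using p_card[OF x(1)] by simp
    then obtain s t where st: "p x = {s, t}" "s \<noteq> t" by (auto simp: card_2_iff)
    then have "s \<in> I" "t \<in> I" using p_sub[OF x(1)] NT by auto
    then have False using I_indep[of s t x] st x by blast
    then show ?thesis ..
  qed
qed

section \<open>Number of components and size of the cutset\<close>

lemma card_lab: "card I + card (l ` U - destroyed) \<le> card (lab ` (Y - W))"
proof -
  have IY: "I \<subseteq> T" "I \<subseteq> T_low" using I_sub by (auto simp: T_low_def)
  have "Inl ` I \<union> Inr ` (l ` U - destroyed) \<subseteq> lab ` (Y - W)"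
  proof
    fix c assume "c \<in> Inl ` I \<union> Inr ` (l ` U - destroyed)"
    then show "c \<in> lab ` (Y - W)"
    proof
      assume "c \<in> Inl ` I"
      then obtain t where t: "t \<in> I" "c = Inl t" by blast
      then have "t \<in> Y - W" using IY ST T_split v_in by (auto simp: W_def U_def)
      then show ?thesis using t by (auto simp: lab_def image_iff intro!: bexI[of _ t])
    next
      assume "c \<in> Inr ` (l ` U - destroyed)"
      then obtain b where b: "b \<in> l ` U" "b \<notin> destroyed" "c = Inr b" by blast
      then obtain y where y: "y \<in> U" "l y = b" "y \<notin> v ` J" by (auto simp: destroyed_def class_def)
      then have "y \<in> Y - W" using T_split by (auto simp: W_def U_def)
      moreover have "y \<notin> I" "y \<notin> spared" using y IY spared_sub by (auto simp: U_def)
      ultimately show ?thesis using b y by (auto simp: lab_def image_iff intro!: bexI[of _ y])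
    qed
  qed
  then have "card (Inl ` I \<union> Inr ` (l ` U - destroyed) :: ('y + 'c) set) \<le> card (lab ` (Y - W))"
    using finite_Y by (intro card_mono) auto
  moreover have "card (Inl ` I \<union> Inr ` (l ` U - destroyed) :: ('y + 'c) set) = card I + card (l ` U - destroyed)"
    using fin' by (subst card_Un_disjoint) (auto simp: card_image)
  ultimately show ?thesis by simp
qed

text \<open>Each hyperedge of \<open>J\<close> deletes at most one vertex, so a destroyed class has
  to save one. A nice class keeps its representative; any other has two hyperedges with the same
  \<open>v x\<close>, or one in \<open>R\<close>, which the right-hand side counts twice.\<close>

lemma card_deleted: "card (v ` J - spared) + card destroyed \<le> card J + card (J \<inter> R)"
proof -
  let ?Jc = "\<lambda>c. {x \<in> J. l (v x) = c}"
  have lJ: "(\<lambda>x. l (v x)) ` J \<subseteq> l ` U" using v_in by auto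
  have fl: "finite (l ` U)" using fin' by simp
  have 1: "card (v ` J - spared) = (\<Sum>c\<in>l ` U. card {y \<in> v ` J - spared. l y = c})"
    using fin' lJ by (intro card_group) auto
  have 2: "card J = (\<Sum>c\<in>l ` U. card (?Jc c))"
    using fin' lJ by (intro card_group) auto
  have 3: "card (J \<inter> R) = (\<Sum>c\<in>l ` U. card {x \<in> J \<inter> R. l (v x) = c})"
    using fin' lJ by (intro card_group) auto
  have "destroyed \<subseteq> l ` U" by (auto simp: destroyed_def)
  then have 4: "card destroyed = (\<Sum>c\<in>l ` U. if c \<in> destroyed then 1 else 0)"
    using fl by (simp add: sum.If_cases Int_absorb1)
  have "(\<Sum>c\<in>l ` U. card {y \<in> v ` J - spared. l y = c} + (if c \<in> destroyed then 1 else 0))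
      \<le> (\<Sum>c\<in>l ` U. card (?Jc c) + card {x \<in> J \<inter> R. l (v x) = c})"
  proof (rule sum_mono)
    fix c assume c: "c \<in> l ` U"
    let ?D = "{y \<in> v ` J - spared. l y = c}"
    have fJ: "finite (?Jc c)" using fin' by simp
    have sub: "?D \<subseteq> v ` ?Jc c" by auto
    have le: "card ?D \<le> card (v ` ?Jc c)" using sub fJ by (intro card_mono) auto
    have le': "card (v ` ?Jc c) \<le> card (?Jc c)" using fJ by (rule card_image_le)
    show "card ?D + (if c \<in> destroyed then 1 else 0) \<le> card (?Jc c) + card {x \<in> J \<inter> R. l (v x) = c}"
    proof (cases "c \<in> destroyed")
      case False
      then show ?thesis using le le' by simp
    next
      case dst: True
      show ?thesis
      proof (cases "c \<in> nice")
        case True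
        then have "rep c \<in> spared" "l (rep c) = c" using rep_in by (auto simp: spared_def)
        then have "rep c \<in> v ` ?Jc c" "rep c \<notin> ?D" using spared_sub by auto
        then have "?D \<subset> v ` ?Jc c" using sub by blast
        then have "card ?D < card (v ` ?Jc c)" using fJ by (intro psubset_card_mono) auto
        then show ?thesis using le' by simp
      next
        case False
        then consider x where "x \<in> J" "l (v x) = c" "x \<in> R" | "\<not> inj_on v (?Jc c)"
          using dst by (auto simp: nice_def)
        then show ?thesis
        proof cases
          case 1
          then have "{x \<in> J \<inter> R. l (v x) = c} \<noteq> {}" by auto
          then have "card {x \<in> J \<inter> R. l (v x) = c} > 0" using fin' by (simp add: card_gt_0_iff)
          then show ?thesis using le le' by simp
        next
          case 2
          then have "card (v ` ?Jc c) \<noteq> card (?Jc c)" using fJ eq_card_imp_inj_on by blast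
          then show ?thesis using le le' by simp
        qed
      qed
    qed
  qed
  then show ?thesis unfolding 1 2 3 4 sum.distrib .
qed

lemma deficit_ge: "2 * card J0 + card (J1 \<inter> R) \<le> deficit"
proof -
  have disj: "J0 \<inter> (J1 \<inter> R) = {}" by (auto simp: J0_def J1_def)
  have "(\<Sum>x\<in>J0 \<union> (J1 \<inter> R). 2 - card (p x)) \<le> deficit"
    unfolding deficit_def using fin by (intro sum_mono2) (auto simp: J0_def)
  moreover have "(\<Sum>x\<in>J0 \<union> (J1 \<inter> R). 2 - card (p x)) = (\<Sum>x\<in>J0. 2 - card (p x)) + (\<Sum>x\<in>J1 \<inter> R. 2 - card (p x))"
    using fin' disj by (intro sum.union_disjoint) auto
  moreover have "(\<Sum>x\<in>J0. 2 - card (p x)) = (\<Sum>x\<in>J0. 2)" by (intro sum.cong) (auto simp: J0_def)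
  moreover have "(\<Sum>x\<in>J1 \<inter> R. 2 - card (p x)) = (\<Sum>x\<in>J1 \<inter> R. 1)" by (intro sum.cong) (auto simp: J1_def)
  ultimately show ?thesis by simp
qed

lemma card_J1: "card J1 = (\<Sum>t\<in>I. loose_count t)"
proof -
  have "J1 = (\<Union>t\<in>I. {x \<in> X. N x \<inter> U \<noteq> {} \<and> p x = {t}})" by (auto simp: J1_def)
  then show ?thesis unfolding loose_count_def using fin' finite_X
    by (simp only:) (subst card_UN_disjoint, auto)
qed

text \<open>Counting the hyperedges of \<open>R\<close> twice is covered by the deficit, which is 2
  for each one in \<open>J0\<close> and 1 for each one in \<open>J1\<close>; the first count of
  \<open>J1\<close> is the sum of the loose hyperedges.\<close>

lemma card_J: "card J + card (J \<inter> R) \<le> (\<Sum>t\<in>I. loose_count t) + deficit"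
proof -
  have "J0 \<inter> J1 = {}" "J0 \<inter> (J1 \<inter> R) = {}" "J \<inter> R = J0 \<union> (J1 \<inter> R)"
    by (auto simp: J_def J0_def J1_def)
  then have "card J = card J0 + card J1" "card (J \<inter> R) = card J0 + card (J1 \<inter> R)"
    unfolding J_def using fin' by (auto intro: card_Un_disjoint)
  then show ?thesis using deficit_ge card_J1 by linarith
qed

lemma count_le_deg: "nbr_count t + loose_count t \<le> d t"
proof -
  let ?A = "{x \<in> X. t \<in> p x \<and> card (p x) = 2}" and ?B = "{x \<in> X. N x \<inter> U \<noteq> {} \<and> p x = {t}}"
  have "{s \<in> T_low. s \<noteq> t \<and> (\<exists>x\<in>X. p x = {t, s})} \<subseteq> (\<lambda>x. the_elem (p x - {t})) ` ?A"
  proof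
    fix s assume "s \<in> {s \<in> T_low. s \<noteq> t \<and> (\<exists>x\<in>X. p x = {t, s})}"
    then obtain x where x: "x \<in> X" "p x = {t, s}" "s \<noteq> t" by blast
    then have "p x - {t} = {s}" by auto
    then have "the_elem (p x - {t}) = s" by simp
    then show "s \<in> (\<lambda>x. the_elem (p x - {t})) ` ?A" using x by (intro rev_image_eqI[of x]) auto
  qed
  then have "nbr_count t \<le> card ((\<lambda>x. the_elem (p x - {t})) ` ?A)"
    unfolding nbr_count_def using finite_X by (intro card_mono) auto
  also have "\<dots> \<le> card ?A" using finite_X by (intro card_image_le) auto
  finally have "nbr_count t \<le> card ?A" .
  moreover have "card ?A + card ?B = card (?A \<union> ?B)"
    using finite_X by (subst card_Un_disjoint) auto
  moreover have "card (?A \<union> ?B) \<le> d t"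
    unfolding sdeg_def using finite_X by (intro card_mono) auto
  ultimately show ?thesis unfolding loose_count_def by linarith
qed

lemma card_W:
  assumes "card T_low \<le> (\<Sum>t\<in>I. 1 + nbr_count t)"
  shows "card W + card destroyed \<le> card S + card T_high + (\<Sum>t\<in>I. nbr_count t + loose_count t) + deficit"
proof -
  have "I \<subseteq> T_low" using I_sub by (auto simp: T_low_def)
  then have "card (T_low - I) = card T_low - card I" using fin' by (intro card_Diff_subset) auto
  then have "card (T_low - I) \<le> (\<Sum>t\<in>I. nbr_count t)" using assms by (simp only: sum.distrib) simp
  moreover have "card W \<le> card S + card T_high + card (T_low - I) + card (v ` J - spared)"
    unfolding W_def by (meson add_mono card_Un_le le_refl order_trans)
  ultimately show ?thesis using card_deleted card_J by (simp add: sum.distrib)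
qed

lemma local_bound:
  "(\<Sum>t\<in>I. (1 + nbr_count t) * (k - d t)) + k * (\<Sum>t\<in>I. nbr_count t + loose_count t) \<le> k * k * card I"
proof -
  have "(\<Sum>t\<in>I. (1 + nbr_count t) * (k - d t) + k * (nbr_count t + loose_count t)) \<le> (\<Sum>t\<in>I. k * k)"
    using I_sub count_le_deg by (intro sum_mono local_bound_arith) auto
  moreover have "(\<Sum>t\<in>I. f t + k * g t) = (\<Sum>t\<in>I. f t) + k * (\<Sum>t\<in>I. g t)" for f g :: "'y \<Rightarrow> nat"
    by (simp add: sum.distrib sum_distrib_left)
  note this[of "\<lambda>t. (1 + nbr_count t) * (k - d t)" "\<lambda>t. nbr_count t + loose_count t"]
  moreover have "(\<Sum>t\<in>I. k * k) = k * k * card I" by simp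
  ultimately show ?thesis by (simp only:)
qed

lemma T_high_le: "card T_high \<le> excess p"
proof -
  have "(\<Sum>t\<in>T_high. 1) \<le> (\<Sum>t\<in>T_high. d t - k)" by (intro sum_mono) (auto simp: T_high_def)
  also have "\<dots> \<le> excess p" unfolding excess_def using fin T_split by (intro sum_mono2) auto
  finally show ?thesis by simp
qed

abbreviation "q \<equiv> card (odd_classes S T R l)"

lemma q_le: "q \<le> card (l ` U)"
  unfolding odd_classes_def U_def using finite_Y by (intro card_mono) auto

lemma card_classes: "card (l ` U) = card (l ` U - destroyed) + card destroyed"
  using fin' by (metis (no_types, lifting) card_Diff_subset card_mono destroyed_def finite_imageI le_add_diff_inverse2 mem_Collect_eq subsetI)

text \<open>The degrees over \<open>T\<close> sum to \<open>k * card T\<close> plus the excess minus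
  the shortfall over \<open>T_low\<close>, and \<open>k * card T\<close> cancels in
  \<open>selection_bound\<close>.\<close>

lemma S_bound: "k * card S + deficit + excess p + 2 \<le> (\<Sum>t\<in>T_low. k - d t) + q"
proof -
  have "(\<Sum>t\<in>T. d t) + (\<Sum>t\<in>T. k - d t) = (\<Sum>t\<in>T. k + (d t - k))"
    unfolding sum.distrib[symmetric] by (intro sum.cong) auto
  then have "(\<Sum>t\<in>T. d t) + (\<Sum>t\<in>T. k - d t) = k * card T + excess p"
    by (simp add: sum.distrib excess_def)
  moreover have "(\<Sum>t\<in>T. k - d t) = (\<Sum>t\<in>T_low. k - d t)"
    using fin by (intro sum.mono_neutral_right) (auto simp: T_low_def)
  ultimately show ?thesis using selection_bound[OF sel] unfolding deficit_def by linarith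
qed

lemma deficit_excess: "0 < deficit + excess p \<Longrightarrow> deficit + excess p + 2 \<le> q"
  unfolding deficit_def by (rule excess_bound[OF sel T3])

text \<open>With all of \<open>T\<close> deleted, only hyperedges of \<open>J0\<close> can violate
  the labelling \<open>l\<close>; each costs one vertex and at most one class.\<close>

lemma second_cut:
  assumes "card (l ` U) \<ge> card J0 + 2"
  shows "k * (card (l ` U) - card J0) \<le> card S + card T + card J0"
proof -
  let ?W = "S \<union> T \<union> v ` J0"
  have vJ0: "v x \<in> N x \<inter> U" if "x \<in> J0" for x using v_in that by (simp add: J_def)
  have "k * (card (l ` U) - card J0) \<le> card ?W"
  proof (rule toughD[OF toughness, where h = l])
    show "?W \<subseteq> Y" using ST vJ0 by (auto simp: U_def)
    show "l y = l z" if x: "x \<in> X" "N x \<inter> ?W = {}" "y \<in> N x" "z \<in> N x" for x y z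
    proof -
      have NU: "N x \<subseteq> U" using x N_subset by (auto simp: U_def)
      have "p x = {}" using p_sub[OF x(1)] x(2) by blast
      have "x \<notin> R"
      proof
        assume "x \<in> R"
        then have "x \<in> J0" using \<open>p x = {}\<close> NU N_nonempty[OF x(1)] by (auto simp: J0_def)
        then show False using vJ0[of x] x(2) by blast
      qed
      then show ?thesis using label_eq[of x y z] x NU by (auto simp: U_def)
    qed
    have "l ` U - l ` v ` J0 \<subseteq> l ` (Y - ?W)" by (auto simp: U_def)
    then have "card (l ` U - l ` v ` J0) \<le> card (l ` (Y - ?W))" using finite_Y by (intro card_mono) auto
    moreover have "card (l ` U) - card (l ` v ` J0) \<le> card (l ` U - l ` v ` J0)"
      using fin' by (intro diff_card_le_card_Diff) auto
    moreover have "card (l ` v ` J0) \<le> card J0"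
      using fin' by (metis card_image_le finite_imageI le_trans)
    ultimately show "card (l ` U) - card J0 \<le> card (l ` (Y - ?W))" by linarith
  qed (use assms in simp)
  also have "card ?W \<le> card S + card T + card (v ` J0)"
    by (meson add_mono card_Un_le le_refl order_trans)
  also have "card (v ` J0) \<le> card J0" using fin' by (intro card_image_le)
  finally show ?thesis by simp
qed

text \<open>\<open>W\<close> has too few vertices for the labels it leaves, so toughness allows at
  most one label: \<open>I\<close> is empty or a singleton, and in the latter case every class is
  destroyed. There the second cut, or the size of \<open>Y\<close>, decides.\<close>

lemma barrier_impossible:
  assumes greedy: "(\<Sum>t\<in>T_low. k - d t) \<le> (\<Sum>t\<in>I. (1 + nbr_count t) * (k - d t))"
    "card T_low \<le> (\<Sum>t\<in>I. 1 + nbr_count t)" and Y: "card Y \<ge> k + 1"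
  shows False
proof -
  let ?r = "card (l ` U)" and ?s = "card (l ` U - destroyed)" and ?EM = "\<Sum>t\<in>I. nbr_count t + loose_count t"
  let ?A = "\<Sum>t\<in>I. (1 + nbr_count t) * (k - d t)"
  have S: "k * card S + deficit + excess p + 2 \<le> ?A + q" using S_bound greedy by linarith
  have small: "card W < k * card I + ?s"
    by (rule cutset_size_arith[OF k_pos card_W[OF greedy(2)] S local_bound T_high_le _ deficit_excess])
      (use q_le card_classes in linarith)
  have "\<not> 2 \<le> card I + ?s"
  proof
    assume two: "2 \<le> card I + ?s"
    have "k * (card I + ?s) \<le> card W"
      by (rule toughD[OF toughness W_sub lab_const card_lab two])
    moreover have "1 * ?s \<le> k * ?s" using k_pos by (rule mult_le_mono1)
    ultimately show False using small by (simp add: distrib_left)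
  qed
  then have le1: "card I + ?s \<le> 1" by simp
  have finW: "finite W" using W_sub finite_Y finite_subset by blast
  have T_card: "card T = card T_high + card T_low"
    using T_split fin' by (metis card_Un_disjoint)
  have def: "2 * card J0 \<le> deficit" using deficit_ge by simp
  show False
  proof (cases "card I = 0")
    case True
    then have I0: "I = {}" using fin' by simp
    then have "T_low = {}" using greedy fin' by simp
    have "card W < ?s" using small True by simp
    then have "card W = 0" using le1 by linarith
    then have "W = {}" using finW by simp
    then have "S = {}" "T_high = {}" by (auto simp: W_def)
    then have "card S + card T = 0" using T_split \<open>T_low = {}\<close> by simp
    have "deficit + excess p + 2 \<le> q" using S I0 by simp
    \<comment> \<open>There are at least \<open>2 * card J0 + 2\<close> classes. As \<open>S\<close>
      and \<open>T\<close> are empty, the second cut removes at most \<open>card J0\<close> vertices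
      and leaves at least \<open>card J0 + 2\<close> classes.\<close>
    then have r: "card J0 + (card J0 + 2) \<le> ?r" using q_le def by linarith
    then have "k * (?r - card J0) \<le> card J0" using second_cut \<open>card S + card T = 0\<close> by simp
    moreover have "1 * (?r - card J0) \<le> k * (?r - card J0)" using k_pos by (rule mult_le_mono1)
    ultimately show False using r by linarith
  next
    case False
    then have "card I = 1" and s0: "?s = 0" using le1 by linarith+
    from this(1) obtain t where I: "I = {t}" by (rule card_1_singletonE)
    have r_dst: "?r = card destroyed" using card_classes s0 by simp
    let ?e = "nbr_count t"
    have S': "k * card S + deficit + excess p + 2 \<le> (1 + ?e) * (k - d t) + q"
      and T': "card T_low \<le> 1 + ?e" using S greedy by (simp_all add: I)
    have loc: "(1 + ?e) * (k - d t) + k * (?e + loose_count t) \<le> k * k"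
      using local_bound by (simp add: I)
    show False
    proof (cases "card J0 + 2 \<le> ?r")
      case True
      define n where "n = ?r - card J0"
      have n: "?r = n + card J0" "2 \<le> n" using True by (auto simp: n_def)
      have cut: "k * n \<le> card S + card T + card J0" using second_cut[OF True] by (simp add: n_def)
      show False
      proof (cases "k = 1")
        case False
        then have "2 \<le> k" using k_pos by simp
        show False
        proof (rule two_classes_arith[OF \<open>2 \<le> k\<close> n(2) cut S' _ _ _ def deficit_excess])
          show "card T \<le> excess p + (1 + ?e)" using T_card T_high_le T' by linarith
          show "(1 + ?e) * (k - d t) + k * (1 + ?e) \<le> k * k + k" using loc by (simp add: distrib_left)
          show "q \<le> n + card J0" using q_le n by simp
        qed
      next
        \<comment> \<open>For \<open>k = 1\<close> the bound \<open>small\<close> already makes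
          \<open>W\<close> empty, so that \<open>T\<close> has at most one vertex.\<close>
        case k1: True
        have "W = {}" using small s0 I k1 finW by simp
        then have "S = {}" "T_high = {}" "T_low \<subseteq> I" unfolding W_def by blast+
        then have "T_low \<subseteq> {t}" by (simp only: I)
        then have "{s \<in> T_low. s \<noteq> t \<and> (\<exists>x\<in>X. p x = {t, s})} = {}" by auto
        then have e0: "?e = 0" unfolding nbr_count_def by (simp only: card.empty)
        have "card T \<le> 1" using T_card \<open>T_high = {}\<close> T' e0 by simp
        have "d t \<le> k" using I_sub I by auto
        \<comment> \<open>\<open>cut\<close> gives \<open>n \<le> 1 + card J0\<close>, hence
          \<open>q \<le> 2 * card J0 + 1\<close>; inserted into \<open>S'\<close> this leaves the
          claim, whose right-hand side is 0 by \<open>def\<close>.\<close>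
        have "d t \<le> 2 * card J0 - deficit"
          using S' e0 k1 q_le n cut \<open>card T \<le> 1\<close> \<open>S = {}\<close> \<open>d t \<le> k\<close> by simp
        then have "loose_count t = 0" using def count_le_deg[of t] by simp
        then have "card destroyed \<le> deficit"
          using card_W[OF greedy(2)] e0 \<open>S = {}\<close> \<open>T_high = {}\<close> by (simp add: I)
        then show False using deficit_excess q_le r_dst n by (cases "deficit = 0") auto
      qed
    next
      \<comment> \<open>A positive deficit or excess would force \<open>card J0 + 2\<close> classes.
        So both vanish, \<open>J0\<close> is empty, and all of \<open>U\<close> is hit by loose
        hyperedges at \<open>t\<close>. This bounds \<open>card Y\<close>, and the parity gap 2
        against \<open>q \<le> 1\<close> contradicts \<open>card Y \<ge> k + 1\<close>.\<close>
      case False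
      have z: "deficit = 0" "excess p = 0"
        using deficit_excess q_le def False by (cases "deficit + excess p = 0"; linarith)+
      then have "card J0 = 0" "card T_high = 0" using def T_high_le by auto
      have "U \<subseteq> v ` J"
      proof
        fix y assume "y \<in> U"
        then have "l y \<in> destroyed" using s0 fin' by auto
        then show "y \<in> v ` J" using \<open>y \<in> U\<close> by (auto simp: destroyed_def class_def)
      qed
      then have "card U \<le> card J" using fin' by (meson card_image_le card_mono finite_imageI le_trans)
      also have "\<dots> \<le> loose_count t" using card_J z I by simp
      finally have cU: "card U \<le> loose_count t" .
      have "Y = S \<union> T \<union> U" using ST by (auto simp: U_def)
      then have "card Y \<le> card S + card T + card U"
        by (metis (no_types, lifting) add_mono card_Un_le le_refl order_trans)
      then have "card Y \<le> card S + (1 + ?e + loose_count t)"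
        using T_card T' cU \<open>card T_high = 0\<close> by linarith
      then have "k * card Y \<le> k * (card S + (1 + ?e + loose_count t))" by (rule mult_le_mono2)
      moreover have "k * (k + 1) \<le> k * card Y" using Y by (rule mult_le_mono2)
      moreover have "q \<le> 1" using q_le False \<open>card J0 = 0\<close> by linarith
      ultimately show False using S' loc by (simp add: distrib_left)
    qed
  qed
qed

end

theorem (in hypergraph) factor_exists:
  assumes tough "\<And>x. x \<in> X \<Longrightarrow> N x \<noteq> {}" "k \<ge> 1" "even (k * card Y)" "card Y \<ge> k + 1"
  shows "\<exists>p. factor p"
proof (rule ccontr)
  assume nf: "\<not> ?thesis"
  \<comment> \<open>The label type is the one that the Tutte--Berge formula produces, so that the
    minimum ranges over barriers of a single type.\<close>
  define P where "P m \<longleftrightarrow> (\<exists>S T R (l :: 'y \<Rightarrow> ('x, 'y) gadget set). barrier S T R l \<and> card T + card R = m)" for m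
  have "\<exists>m. P m" unfolding P_def using exists_barrier[OF nf] by blast
  then obtain m where m: "P m" "\<And>m'. P m' \<Longrightarrow> m \<le> m'" by (metis LeastI Least_le)
  obtain S T R and l :: "'y \<Rightarrow> ('x, 'y) gadget set" where b: "barrier S T R l" "card T + card R = m"
    using m(1) unfolding P_def by blast
  interpret minimal_barrier X Y N k S T R l
  proof
    fix S' T' R' and l' :: "'y \<Rightarrow> ('x, 'y) gadget set"
    assume "barrier S' T' R' l'"
    then have "P (card T' + card R')" unfolding P_def by blast
    then show "card T + card R \<le> card T' + card R'" using m(2) b(2) by simp
  qed (use b assms in auto)
  obtain p T3 where p: "selection p" "T3 \<subseteq> T" "\<And>t. t \<in> T \<Longrightarrow> k < sdeg p t \<Longrightarrow> t \<in> T3"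
    "\<And>t. t \<in> T3 \<Longrightarrow> k \<le> sdeg p t" "\<And>x. x \<in> X \<Longrightarrow> p x \<inter> T3 \<noteq> {} \<Longrightarrow> N x \<inter> T - p x \<subseteq> T3"
    using closed_selection by metis
  define adj where "adj t s \<longleftrightarrow> s \<noteq> t \<and> (\<exists>x\<in>X. p x = {t, s})" for t s
  let ?L = "{t \<in> T. sdeg p t \<le> k}"
  obtain I where I: "I \<subseteq> ?L" "\<forall>s\<in>I. \<forall>t\<in>I. \<not> adj s t"
    "(\<Sum>t\<in>?L. k - sdeg p t) \<le> (\<Sum>t\<in>I. (1 + card {s \<in> ?L. adj t s}) * (k - sdeg p t))"
    "card ?L \<le> (\<Sum>t\<in>I. 1 + card {s \<in> ?L. adj t s})"
  proof -
    have "adj t s" if "adj s t" for s t using that by (auto simp: adj_def insert_commute)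
    moreover have "\<not> adj t t" for t by (simp add: adj_def)
    moreover have "finite ?L" using fin by simp
    ultimately show thesis using greedy_independent_set[of ?L adj "\<lambda>t. k - sdeg p t"] that by blast
  qed
  interpret tough_barrier X Y N k S T R l p T3 I
  proof
    show "p x \<noteq> {s, t}" if "s \<in> I" "t \<in> I" "s \<noteq> t" "x \<in> X" for s t x
      using I(2) that unfolding adj_def by metis
  qed (fact assms(1,2,3) p I(1))+
  have "nbr_count t = card {s \<in> ?L. adj t s}" for t by (simp add: nbr_count_def T_low_def adj_def)
  then show False using barrier_impossible I(3,4) assms(5) unfolding T_low_def by simp
qed

section \<open>Graphs and hypergraphs\<close>

text \<open>\<open>f\<close> is constant along reachability, so it factors through the strong
  components.\<close>

lemma (in fin_digraph) card_arc_invariant_le_sccs: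
  assumes "\<And>u v. u \<rightarrow> v \<Longrightarrow> f u = f v"
  shows "card (f ` verts G) \<le> card sccs"
proof -
  have reach: "f u = f v" if "u \<rightarrow>\<^sup>* v" for u v
    using that by (induction rule: reachable_induct) (auto dest: assms)
  have "f u = f (SOME w. w \<in> scc_of u)" if "u \<in> verts G" for u
  proof -
    have "(SOME w. w \<in> scc_of u) \<in> scc_of u" using in_scc_of_self[OF that] by (rule someI)
    then show ?thesis using reach by (auto simp: scc_of_def)
  qed
  then have "f ` verts G = (\<lambda>C. f (SOME w. w \<in> C)) ` sccs_verts"
    unfolding sccs_verts_conv_scc_of image_image by (rule image_cong[OF refl])
  then have "card (f ` verts G) \<le> card sccs_verts"
    using finite_sccs_verts by (simp add: card_image_le)
  then show ?thesis by (simp add: card_sccs_verts)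
qed

text \<open>The labelling of \<open>Y - W\<close> extends to the remaining vertices of
  \<open>X\<close>, so it has at most as many values as there are components. Two values make
  \<open>W\<close> a cutset, and having more components than values only strengthens the toughness
  inequality.\<close>

lemma tough_of_Y_toughness:
  assumes G: "graph G" and bip: "bipartition G X Y"
    and tough: "Y_toughness G Y \<ge> ereal (real k)"
    and hyp: "hypergraph X Y (\<lambda>x. {y. x \<rightarrow>\<^bsub>G\<^esub> y})"
  shows "hypergraph.tough X Y (\<lambda>x. {y. x \<rightarrow>\<^bsub>G\<^esub> y}) k"
  unfolding hypergraph.tough_def[OF hyp]
proof (intro allI impI)
  fix W and h :: "'a \<Rightarrow> nat"
  interpret graph G by fact
  let ?N = "\<lambda>x. {y. x \<rightarrow>\<^bsub>G\<^esub> y}" and ?H = "strong_deletion G W"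
  assume W: "W \<subseteq> Y" and const: "\<forall>x\<in>X. ?N x \<inter> W = {} \<longrightarrow> (\<forall>y\<in>?N x. \<forall>z\<in>?N x. h y = h z)"
    and two: "2 \<le> card (h ` (Y - W))"
  have XY: "X \<union> Y = verts G" "X \<inter> Y = {}" using bip by (auto simp: bipartition_def)
  have edge: "u \<in> X \<and> v \<in> Y \<or> u \<in> Y \<and> v \<in> X" if "u \<rightarrow>\<^bsub>G\<^esub> v" for u v
    using bip that unfolding bipartition_def by blast
  have finY: "finite Y" using XY finite_verts by (metis finite_Un)
  let ?V = "verts G - (W \<union> neighbourhood G W)"
  have "induced_subgraph ?H G" unfolding strong_deletion_def by (intro induced_induce) auto
  then interpret H: fin_digraph ?H by (intro fin_digraph_subgraph induced_imp_subgraph)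
  \<comment> \<open>A remaining \<open>x\<close> has no neighbour in \<open>W\<close>, so
    \<open>h\<close> agrees on all its neighbours and any of them may give the label.\<close>
  define f where "f u = (if u \<in> Y then h u else h (SOME y. u \<rightarrow>\<^bsub>G\<^esub> y))" for u
  have f_xy: "f x = f y" if xy: "x \<in> X" "y \<in> Y" "x \<rightarrow>\<^bsub>G\<^esub> y" "x \<in> ?V" for x y
  proof -
    have s: "(SOME y. x \<rightarrow>\<^bsub>G\<^esub> y) \<in> ?N x" using someI[of "\<lambda>y. x \<rightarrow>\<^bsub>G\<^esub> y", OF xy(3)] by simp
    have "?N x \<inter> W = {}" using xy(4) graph_symmetric by (auto simp: neighbourhood_def)
    moreover have "y \<in> ?N x" using xy(3) by simp
    ultimately have "h (SOME y. x \<rightarrow>\<^bsub>G\<^esub> y) = h y" using const xy(1) s by blast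
    moreover have "x \<notin> Y" using xy XY by blast
    ultimately show ?thesis using xy(2) by (simp add: f_def)
  qed
  have "f u = f v" if uv: "u \<rightarrow>\<^bsub>?H\<^esub> v" for u v
  proof -
    have e: "u \<rightarrow>\<^bsub>G\<^esub> v" using uv dominates_induce_subgraphD unfolding strong_deletion_def by metis
    have V: "u \<in> ?V" "v \<in> ?V" using uv unfolding strong_deletion_def by (auto simp: arcs_ends_conv)
    show ?thesis using edge[OF e] f_xy[of u v] f_xy[of v u] e V graph_symmetric[OF e] by auto
  qed
  then have "card (f ` verts ?H) \<le> num_components ?H"
    unfolding num_components_def by (rule H.card_arc_invariant_le_sccs)
  moreover have "h ` (Y - W) \<subseteq> f ` verts ?H"
  proof
    fix c assume "c \<in> h ` (Y - W)"
    then obtain y where y: "y \<in> Y" "y \<notin> W" "c = h y" by blast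
    have "y \<notin> neighbourhood G W" using edge[of _ y] y(1) XY(2) W unfolding neighbourhood_def by blast
    then have "y \<in> verts ?H" using y XY by (auto simp: strong_deletion_def)
    then show "c \<in> f ` verts ?H" using y by (auto simp: f_def)
  qed
  then have "card (h ` (Y - W)) \<le> card (f ` verts ?H)" by (intro card_mono) auto
  ultimately have le: "card (h ` (Y - W)) \<le> num_components ?H" by linarith
  then have "Y_cutset G Y W" using W two by (simp add: Y_cutset_def)
  then have "real k * real (num_components ?H) \<le> real (card W)"
    using tough Y_toughness_ge_iff[OF finY] by blast
  then have "k * num_components ?H \<le> card W" by (metis of_nat_le_iff of_nat_mult)
  then show "k * card (h ` (Y - W)) \<le> card W" using le by (meson le_trans mult_le_mono2)
qed

lemma two_k_factor_of_selection:
  assumes G: "graph G" and bip: "bipartition G X Y"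
    and p: "\<And>x. x \<in> X \<Longrightarrow> p x \<subseteq> {y. x \<rightarrow>\<^bsub>G\<^esub> y} \<and> (p x = {} \<or> card (p x) = 2)"
      "\<And>y. y \<in> Y \<Longrightarrow> card {x \<in> X. y \<in> p x} = k"
  shows "\<exists>F. two_k_factor G X Y k F"
proof -
  interpret graph G by fact
  have XY: "X \<union> Y = verts G" "X \<inter> Y = {}" using bip by (auto simp: bipartition_def)
  have edge: "u \<in> X \<and> v \<in> Y \<or> u \<in> Y \<and> v \<in> X" if "u \<rightarrow>\<^bsub>G\<^esub> v" for u v
    using bip that unfolding bipartition_def by blast
  have pY: "y \<in> Y" "x \<rightarrow>\<^bsub>G\<^esub> y" "y \<notin> X" if "x \<in> X" "y \<in> p x" for x y
    using p(1)[OF that(1)] that edge[of x y] XY by auto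
  \<comment> \<open>Both orientations of each chosen incidence are kept, which makes
    \<open>F\<close> symmetric. Vertices of \<open>X\<close> that select nothing are left out of
    \<open>F\<close>, as their degree would be 0 instead of 2.\<close>
  define A where "A = {a \<in> arcs G. tail G a \<in> X \<and> head G a \<in> p (tail G a) \<or> head G a \<in> X \<and> tail G a \<in> p (head G a)}"
  define F where "F = \<lparr>verts = Y \<union> {x \<in> X. p x \<noteq> {}}, arcs = A, tail = tail G, head = head G\<rparr>"
  have F [simp]: "verts F = Y \<union> {x \<in> X. p x \<noteq> {}}" "arcs F = A" "tail F = tail G" "head F = head G"
    by (simp_all add: F_def)
  have AG: "A \<subseteq> arcs G" by (auto simp: A_def)
  have inj_head: "inj_on (head G) (out_arcs F u)" for u
  proof (rule inj_onI)
    fix a b assume "a \<in> out_arcs F u" "b \<in> out_arcs F u" "head G a = head G b"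
    then have "a \<in> arcs G" "b \<in> arcs G" "arc_to_ends G a = arc_to_ends G b"
      using AG by (auto simp: out_arcs_def arc_to_ends_def)
    then show "a = b" by (rule no_multi_arcs)
  qed
  have V: "verts F \<subseteq> verts G" using XY by auto
  have "graph F"
  proof
    show "tail F a \<in> verts F" "head F a \<in> verts F" if "a \<in> arcs F" for a
      using that pY by (auto simp: A_def)
    show "finite (verts F)" using V finite_verts finite_subset by blast
    show "finite (arcs F)" using finite_subset[OF AG] by simp
    show "tail F a \<noteq> head F a" if "a \<in> arcs F" for a using that AG no_loops by auto
    show "a = b" if "a \<in> arcs F" "b \<in> arcs F" "arc_to_ends F a = arc_to_ends F b" for a b
      using that AG no_multi_arcs[of a b] by (auto simp: arc_to_ends_def)
    show "symmetric F" unfolding symmetric_conv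
    proof
      fix a assume "a \<in> arcs F"
      then have a: "a \<in> arcs G" "a \<in> A" using AG by auto
      then obtain b where "b \<in> arcs G" "tail G a = head G b" "head G a = tail G b"
        using sym_arcs unfolding symmetric_conv by blast
      then have "b \<in> A" using a by (auto simp: A_def)
      then show "\<exists>b\<in>arcs F. tail F a = head F b \<and> head F a = tail F b"
        using \<open>tail G a = head G b\<close> \<open>head G a = tail G b\<close> by auto
    qed
  qed
  moreover have "subgraph F G"
    unfolding subgraph_def compatible_def using V AG wf_digraph \<open>graph F\<close>
    by (auto simp: graph_def digraph_def fin_digraph_def)
  moreover have "out_degree F x = 2" if x: "x \<in> verts F \<inter> X" for x
  proof -
    have px: "x \<in> X" "p x \<noteq> {}" using x XY by auto
    have "bij_betw (head G) (out_arcs F x) (p x)"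
      unfolding bij_betw_def
    proof
      show "inj_on (head G) (out_arcs F x)" by (rule inj_head)
      show "head G ` out_arcs F x = p x"
      proof
        show "head G ` out_arcs F x \<subseteq> p x" using px pY by (auto simp: out_arcs_def A_def)
        show "p x \<subseteq> head G ` out_arcs F x"
        proof
          fix y assume y: "y \<in> p x"
          then obtain a where "a \<in> arcs G" "tail G a = x" "head G a = y" using pY[OF px(1) y] by auto
          then show "y \<in> head G ` out_arcs F x" using y px by (auto simp: out_arcs_def A_def)
        qed
      qed
    qed
    then show ?thesis using p(1)[OF px(1)] px by (simp add: out_degree_def bij_betw_same_card)
  qed
  moreover have "out_degree F y = k" if y: "y \<in> Y" for y
  proof -
    have yX: "y \<notin> X" using y XY by auto
    have "bij_betw (head G) (out_arcs F y) {x \<in> X. y \<in> p x}"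
      unfolding bij_betw_def
    proof
      show "inj_on (head G) (out_arcs F y)" by (rule inj_head)
      show "head G ` out_arcs F y = {x \<in> X. y \<in> p x}"
      proof
        show "head G ` out_arcs F y \<subseteq> {x \<in> X. y \<in> p x}" using yX by (auto simp: out_arcs_def A_def)
        show "{x \<in> X. y \<in> p x} \<subseteq> head G ` out_arcs F y"
        proof
          fix x assume x: "x \<in> {x \<in> X. y \<in> p x}"
          then have "y \<rightarrow>\<^bsub>G\<^esub> x" using pY[of x y] graph_symmetric by auto
          then obtain a where "a \<in> arcs G" "tail G a = y" "head G a = x" by auto
          then show "x \<in> head G ` out_arcs F y" using x by (auto simp: out_arcs_def A_def)
        qed
      qed
    qed
    then show ?thesis using p(2)[OF y] by (simp add: out_degree_def bij_betw_same_card)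
  qed
  ultimately have "two_k_factor G X Y k F" unfolding two_k_factor_def by auto
  then show ?thesis by blast
qed

theorem theorem2p1:
  fixes G :: "('a, 'b) pre_digraph" and X Y :: "'a set" and k :: nat
  assumes "graph G"
    and "bipartition G X Y"
    and "\<forall>x\<in>X. \<not> isolated_vertex G x"
    and "k \<ge> 1"
    and "Y_toughness G Y \<ge> ereal (real k)"
    and "even (k * card Y)"
    and "card Y \<ge> k + 1"
  shows "\<exists>F. two_k_factor G X Y k F"
proof -
  interpret graph G by fact
  let ?N = "\<lambda>x. {y. x \<rightarrow>\<^bsub>G\<^esub> y}"
  have XY: "X \<union> Y = verts G" "X \<inter> Y = {}" using assms(2) by (auto simp: bipartition_def)
  have edge: "u \<in> X \<and> v \<in> Y \<or> u \<in> Y \<and> v \<in> X" if "u \<rightarrow>\<^bsub>G\<^esub> v" for u v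
    using assms(2) that unfolding bipartition_def by blast
  have "finite X" "finite Y" using XY finite_verts by (metis finite_Un)+
  then interpret hyp: hypergraph X Y ?N k
    by unfold_locales (use edge XY in auto)
  have "hyp.tough" using tough_of_Y_toughness[OF assms(1,2,5)] hyp.hypergraph_axioms by blast
  moreover have "?N x \<noteq> {}" if "x \<in> X" for x
    using assms(3) that XY by (auto simp: isolated_vertex_def)
  ultimately obtain p where "hyp.factor p" using hyp.factor_exists assms(4,6,7) by blast
  then show ?thesis
    unfolding hyp.factor_def by (intro two_k_factor_of_selection[OF assms(1,2), of p]) blast+
qed

end
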